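(* Let $1\le k<n$ and $0\le\ell\le k$ be integers, and let $|\psi\rangle\in\mathcal H_{n,\ell}$ be a leaf-separable target state with respect to the leaves of the balanced partition tree $T$ of $n$ qubits with leaf size at most $k$. The leaf-separable state preparation algorithm for $|\psi\rangle$ (defined in the context) can be implemented by a quantum circuit with no ancilla qubits, of depth $O\!\left(k\left(\log\frac nk+2^k\right)\right)$ and using $O(nk2^k)$ two-qubit gates. Moreover, using $G=\lceil n/k\rceil$ ancilla qubits, the algorithm can be implemented by a quantum circuit of depth $O\!\left(k\log\frac nk+2^k\right)$ using $O\!\left(n(k+2^k)\right)$ two-qubit gates. The implied constants are absolute.
   Context: Circuits consist of arbitrary one-qubit and two-qubit gates with all-to-all connectivity. Notation. $h(b)$ is the Hamming weight of a bitstring $b$; $\mathcal H_{m,j}$ is the span of the basis states $|b\rangle$, $b\in\{0,1\}^m$, $h(b)=j$. Partition tree. Split the ordered qubits into $G=\lceil n/k\rceil$ consecutive chunks, each of size $k$ except possibly the last, which may be smaller. $T$ is the binary tree whose leaves are these chunks, built recursively: a list of $M\ge2$ consecutive chunks is an internal node whose left child is built from the first $\lfloor M/2\rfloor$ chunks and whose right child from the remaining ones. Each node $v$ carries its set of qubits $Q_v$, $n_v=|Q_v|$; an internal node $v$ has children $L_v,R_v$ and $m_v=n_{L_v}$. $\mathrm{Int}(T)$ is the set of internal nodes. The leaves, in order, are $u=1,\dots,G$, of sizes $n_u$. Leaf-separability. Write $|\psi\rangle=\sum_{h(b)=\ell}\alpha_b|b\rangle$ (unit vector), and $b=g_1\cdots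 g_G$ with $g_u\in\{0,1\}^{n_u}$, $I(b)=(h(g_1),\dots,h(g_G))$. For $I=(i_1,\dots,i_G)$ with $\sum_u i_u=\ell$ put $c(I)=\sqrt{\sum_{I(b)=I}|\alpha_b|^2}$ and, if $c(I)\ne0$, $|\psi_I\rangle=c(I)^{-1}\sum_{I(b)=I}\alpha_b|b\rangle$. $|\psi\rangle$ is leaf-separable if every such $|\psi_I\rangle$ is a product vector $\bigotimes_{u=1}^G|\psi_{i_u}\rangle$ with $|\psi_{i_u}\rangle\in\mathcal H_{n_u,i_u}$. Generalized weight distribution blocks. For $v\in\mathrm{Int}(T)$ let $\alpha^v_{i,j}=\sqrt{\sum|\alpha_b|^2}$, the sum over $b$ whose restriction to $Q_{L_v}$ has weight $i$ and whose restriction to $Q_{R_v}$ has weight $j$; let $\alpha^v_j=\sqrt{\sum_{i=0}^j|\alpha^v_{i,j-i}|^2}$ and $\beta^{v,j}_i=\alpha^v_{i,j-i}/\alpha^v_j$ when $\alpha_j^v\ne0$. A generalized weight distribution block at $v$ is a unitary $gWDB_k^{n_v,m_v}$ on the qubits $Q_v$ with $$gWDB_k^{n_v,m_v}|0^{n_v-j}1^j\rangle=\sum_{i=0}^j\beta_i^{v,j}|0^{m_v-i}1^i\rangle|0^{n_v-m_v-(j-i)}1^{j-i}\rangle$$ for all $0\le j\le\min(k,n_v)$ with $\alpha^v_j\neq0$ (terms with $i>m_v$ or $j-i>n_v-m_v$ have coefficient $0$ and are omitted). Leaf encoders. For $I$ with $c(I)\neq0$ let $b^*=g_1^*\cdots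 g_G^*$ be the lexicographically smallest $b$ with $I(b)=I$, $\alpha_b\ne0$; for $g\in\{0,1\}^{n_u}$ with $h(g)=i_u$ let $\gamma_{u,i_u}(g)=\alpha_{g_1^*\cdots g_{u-1}^*\,g\,g_{u+1}^*\cdots g_G^*}/\alpha_{b^*}$ and $\eta_{u,i_u}(g)=\gamma_{u,i_u}(g)\big/\sqrt{\sum_{g'}|\gamma_{u,i_u}(g')|^2}$. For each pair $(u,i)$ the function $\eta_{u,i}$ is taken from the first $I$ (in a fixed enumeration) with $i_u=i$ and $c(I)\ne0$, if one exists. The leaf encoder is a unitary $E^u$ on the qubits of leaf $u$ with $E^u|0^{n_u-i}1^i\rangle=\sum_{h(g)=i}\eta_{u,i}(g)|g\rangle$ for every $0\le i\le \min(\ell,n_u)$ for which $\eta_{u,i}$ is defined. Algorithm. Prepare $|0^{n-\ell}1^\ell\rangle$; apply $gWDB_k^{n_v,m_v}$ at every $v\in\mathrm{Int}(T)$, parents before children; then apply $E^u$ at every leaf $u$. Ancilla qubits, if used, are extra qubits initialized to $|0\rangle$ on which the circuit may also act. *)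

theory Defs
  imports Complex_Main "HOL-Library.List_Lexorder"
begin

section \<open>Bitstrings, states and operators\<close>

text \<open>
  Qubits are numbered from 0.  A state of \<open>N\<close> qubits is its amplitude function on bitstrings; only
  the values at bitstrings of length \<open>N\<close> matter.  An operator on \<open>m\<close> qubits is a matrix indexed by
  bitstrings of length \<open>m\<close>, the first index being the row.
\<close>

type_synonym bits = "bool list"
type_synonym state = "bits \<Rightarrow> complex"
type_synonym operator = "bits \<Rightarrow> bits \<Rightarrow> complex"

definition bitstrings :: "nat \<Rightarrow> bits set" where
  "bitstrings m = {b. length b = m}"

definition hw :: "bits \<Rightarrow> nat" where
  "hw b = count_list b True"

definition zeros :: "nat \<Rightarrow> bits" where
  "zeros m = replicate m False"

definition unary :: "nat \<Rightarrow> nat \<Rightarrow> bits" where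
  "unary m i = replicate (m - i) False @ replicate i True"

definition restrict_bits :: "bits \<Rightarrow> nat list \<Rightarrow> bits" where
  "restrict_bits b ps = map (\<lambda>p. b ! p) ps"

definition replace_bits :: "bits \<Rightarrow> nat list \<Rightarrow> bits \<Rightarrow> bits" where
  "replace_bits b ps g = fold (\<lambda>(p, x) b'. b'[p := x]) (zip ps g) b"

definition ket :: "bits \<Rightarrow> state" where
  "ket b = (\<lambda>b'. if b' = b then 1 else 0)"

definition weight_space :: "nat \<Rightarrow> nat \<Rightarrow> state set" where
  "weight_space m j = {\<phi>. \<forall>b. \<phi> b \<noteq> 0 \<longrightarrow> b \<in> bitstrings m \<and> hw b = j}"

definition unit_state :: "nat \<Rightarrow> state \<Rightarrow> bool" where
  "unit_state m \<phi> \<longleftrightarrow> (\<Sum>b\<in>bitstrings m. (cmod (\<phi> b))\<^sup>2) = 1"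

definition unitary :: "nat \<Rightarrow> operator \<Rightarrow> bool" where
  "unitary m U \<longleftrightarrow>
     (\<forall>x\<in>bitstrings m. \<forall>y\<in>bitstrings m.
        (\<Sum>z\<in>bitstrings m. cnj (U z x) * U z y) = (if x = y then 1 else 0) \<and>
        (\<Sum>z\<in>bitstrings m. U x z * cnj (U y z)) = (if x = y then 1 else 0))"

text \<open>The operator \<open>U\<close> on the qubits \<open>ps\<close> (in this order), tensored with the identity elsewhere.\<close>

definition apply_on :: "nat list \<Rightarrow> operator \<Rightarrow> state \<Rightarrow> state" where
  "apply_on ps U \<phi> =
     (\<lambda>b. \<Sum>y\<in>bitstrings (length ps). U (restrict_bits b ps) y * \<phi> (replace_bits b ps y))"


section \<open>Circuits\<close>

type_synonym gate = "nat list \<times> operator"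

definition valid_gate :: "nat \<Rightarrow> gate \<Rightarrow> bool" where
  "valid_gate N = (\<lambda>(ps, U).
     length ps \<in> {1, 2} \<and> distinct ps \<and> set ps \<subseteq> {..<N} \<and> unitary (length ps) U)"

text \<open>Gates are listed in order of application (head first).\<close>

type_synonym circuit = "gate list"

definition valid_circuit :: "nat \<Rightarrow> circuit \<Rightarrow> bool" where
  "valid_circuit N C \<longleftrightarrow> (\<forall>g\<in>set C. valid_gate N g)"

definition run :: "circuit \<Rightarrow> state \<Rightarrow> state" where
  "run C = fold (\<lambda>(ps, U). apply_on ps U) C"

definition two_qubit_gates :: "circuit \<Rightarrow> nat" where
  "two_qubit_gates C = length (filter (\<lambda>(ps, U). length ps = 2) C)"

text \<open>
  Depth is the number of layers when every gate (of either kind) is put into the earliest possible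
  layer, i.e. the maximal length of a chain of gates in which consecutive gates share a qubit;
  \<open>busy C q\<close> is the last layer using qubit \<open>q\<close> (0 if there is none).
\<close>

definition schedule :: "gate \<Rightarrow> (nat \<Rightarrow> nat) \<Rightarrow> (nat \<Rightarrow> nat)" where
  "schedule = (\<lambda>(ps, U) t q. if q \<in> set ps then Suc (Max (t ` set ps)) else t q)"

definition busy :: "circuit \<Rightarrow> nat \<Rightarrow> nat" where
  "busy C = fold schedule C (\<lambda>_. 0)"

definition depth :: "nat \<Rightarrow> circuit \<Rightarrow> nat" where
  "depth N C = Max (busy C ` {..<N})"

text \<open>
  The main register consists of the qubits \<open>0, \<dots>, n - 1\<close>, followed by \<open>a\<close> ancillas.  A circuit
  realizes \<open>U\<close> on the main qubits \<open>ps\<close> if it acts as \<open>U\<close> on every input whose ancillas are all zero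
  (by linearity, basis inputs suffice); in particular the ancillas end up zero again.
\<close>

definition realizes :: "nat \<Rightarrow> nat \<Rightarrow> nat list \<Rightarrow> operator \<Rightarrow> circuit \<Rightarrow> bool" where
  "realizes n a ps U C \<longleftrightarrow> valid_circuit (n + a) C \<and>
     (\<forall>x\<in>bitstrings n. \<forall>b\<in>bitstrings (n + a).
        run C (ket (x @ zeros a)) b = apply_on ps U (ket (x @ zeros a)) b)"

definition prepares :: "nat \<Rightarrow> nat \<Rightarrow> bits \<Rightarrow> circuit \<Rightarrow> bool" where
  "prepares n a x C \<longleftrightarrow> valid_circuit (n + a) C \<and>
     (\<forall>b\<in>bitstrings (n + a). run C (ket (zeros (n + a))) b = ket (x @ zeros a) b)"


section \<open>The partition tree\<close>

definition num_leaves :: "nat \<Rightarrow> nat \<Rightarrow> nat" where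
  "num_leaves n k = nat \<lceil>real n / real k\<rceil>"

text \<open>Leaves are numbered from 0.\<close>

definition leaf :: "nat \<Rightarrow> nat \<Rightarrow> nat \<Rightarrow> nat list" where
  "leaf n k u = [u * k ..< min n (Suc u * k)]"

definition leaf_size :: "nat \<Rightarrow> nat \<Rightarrow> nat \<Rightarrow> nat" where
  "leaf_size n k u = length (leaf n k u)"

datatype ptree = Leaf "nat list" | Node ptree ptree

fun qubits :: "ptree \<Rightarrow> nat list" where
  "qubits (Leaf Q) = Q"
| "qubits (Node l r) = qubits l @ qubits r"

function build :: "nat list list \<Rightarrow> ptree" where
  "build [] = Leaf []"
| "build [Q] = Leaf Q"
| "build (Q # Q' # Qs) =
     (let cs = Q # Q' # Qs; h = length cs div 2 in Node (build (take h cs)) (build (drop h cs)))"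
  by pat_completeness auto
termination
  by (relation "measure length") auto

definition partition_tree :: "nat \<Rightarrow> nat \<Rightarrow> ptree" where
  "partition_tree n k = build (map (leaf n k) [0..<num_leaves n k])"

text \<open>
  An internal node is represented by the pair of qubit lists of its two children.  The internal nodes
  are listed in preorder, so parents come before children.
\<close>

type_synonym node = "nat list \<times> nat list"

fun internal_nodes :: "ptree \<Rightarrow> node list" where
  "internal_nodes (Leaf Q) = []"
| "internal_nodes (Node l r) = (qubits l, qubits r) # internal_nodes l @ internal_nodes r"

definition node_qubits :: "node \<Rightarrow> nat list" where
  "node_qubits v = fst v @ snd v"


section \<open>Leaf-separability\<close>

definition leaf_weights :: "nat \<Rightarrow> nat \<Rightarrow> bits \<Rightarrow> nat list" where
  "leaf_weights n k b = map (\<lambda>u. hw (restrict_bits b (leaf n k u))) [0..<num_leaves n k]"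

definition weight_tuples :: "nat \<Rightarrow> nat \<Rightarrow> nat \<Rightarrow> nat list set" where
  "weight_tuples n k l = {I. length I = num_leaves n k \<and> sum_list I = l}"

definition sector_norm :: "nat \<Rightarrow> nat \<Rightarrow> state \<Rightarrow> nat list \<Rightarrow> real" where
  "sector_norm n k \<alpha> I =
     sqrt (\<Sum>b\<in>{b \<in> bitstrings n. leaf_weights n k b = I}. (cmod (\<alpha> b))\<^sup>2)"

definition sector_state :: "nat \<Rightarrow> nat \<Rightarrow> state \<Rightarrow> nat list \<Rightarrow> state" where
  "sector_state n k \<alpha> I =
     (\<lambda>b. if b \<in> bitstrings n \<and> leaf_weights n k b = I
          then \<alpha> b / complex_of_real (sector_norm n k \<alpha> I) else 0)"

definition leaf_separable :: "nat \<Rightarrow> nat \<Rightarrow> nat \<Rightarrow> state \<Rightarrow> bool" where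
  "leaf_separable n k l \<alpha> \<longleftrightarrow>
     (\<forall>I \<in> weight_tuples n k l. sector_norm n k \<alpha> I \<noteq> 0 \<longrightarrow>
        (\<exists>\<phi> :: nat \<Rightarrow> state.
           (\<forall>u < num_leaves n k. \<phi> u \<in> weight_space (leaf_size n k u) (I ! u)) \<and>
           (\<forall>b \<in> bitstrings n. sector_state n k \<alpha> I b =
              (\<Prod>u < num_leaves n k. \<phi> u (restrict_bits b (leaf n k u))))))"


section \<open>Generalized weight distribution blocks\<close>

definition split_amp :: "nat \<Rightarrow> state \<Rightarrow> node \<Rightarrow> nat \<Rightarrow> nat \<Rightarrow> real" where
  "split_amp n \<alpha> v i j =
     sqrt (\<Sum>b\<in>{b \<in> bitstrings n. hw (restrict_bits b (fst v)) = i \<and>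
                                  hw (restrict_bits b (snd v)) = j}. (cmod (\<alpha> b))\<^sup>2)"

definition node_amp :: "nat \<Rightarrow> state \<Rightarrow> node \<Rightarrow> nat \<Rightarrow> real" where
  "node_amp n \<alpha> v j = sqrt (\<Sum>i\<le>j. \<bar>split_amp n \<alpha> v i (j - i)\<bar>\<^sup>2)"

definition node_coeff :: "nat \<Rightarrow> state \<Rightarrow> node \<Rightarrow> nat \<Rightarrow> nat \<Rightarrow> real" where
  "node_coeff n \<alpha> v j i = split_amp n \<alpha> v i (j - i) / node_amp n \<alpha> v j"

definition is_gWDB :: "nat \<Rightarrow> nat \<Rightarrow> state \<Rightarrow> node \<Rightarrow> operator \<Rightarrow> bool" where
  "is_gWDB n k \<alpha> v U \<longleftrightarrow>
     (let nv = length (node_qubits v); m = length (fst v) in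
        unitary nv U \<and>
        (\<forall>j \<le> min k nv. node_amp n \<alpha> v j \<noteq> 0 \<longrightarrow>
           (\<forall>y \<in> bitstrings nv. U y (unary nv j) =
              (\<Sum>i\<in>{i. i \<le> j \<and> i \<le> m \<and> j - i \<le> nv - m}.
                 complex_of_real (node_coeff n \<alpha> v j i) *
                 ket (unary m i @ unary (nv - m) (j - i)) y))))"


section \<open>Leaf encoders\<close>

text \<open>The order on bitstrings (and hence \<open>Min\<close>) is lexicographic.\<close>

definition ref_string :: "nat \<Rightarrow> nat \<Rightarrow> state \<Rightarrow> nat list \<Rightarrow> bits" where
  "ref_string n k \<alpha> I = Min {b \<in> bitstrings n. leaf_weights n k b = I \<and> \<alpha> b \<noteq> 0}"

definition leaf_ratio :: "nat \<Rightarrow> nat \<Rightarrow> state \<Rightarrow> nat list \<Rightarrow> nat \<Rightarrow> bits \<Rightarrow> complex" where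
  "leaf_ratio n k \<alpha> I u g =
     \<alpha> (replace_bits (ref_string n k \<alpha> I) (leaf n k u) g) / \<alpha> (ref_string n k \<alpha> I)"

definition leaf_coeff :: "nat \<Rightarrow> nat \<Rightarrow> state \<Rightarrow> nat list \<Rightarrow> nat \<Rightarrow> bits \<Rightarrow> complex" where
  "leaf_coeff n k \<alpha> I u g =
     leaf_ratio n k \<alpha> I u g /
     complex_of_real (sqrt (\<Sum>g'\<in>{g' \<in> bitstrings (leaf_size n k u). hw g' = I ! u}.
                               (cmod (leaf_ratio n k \<alpha> I u g'))\<^sup>2))"

text \<open>\<open>Is\<close> is an enumeration of the weight tuples.\<close>

definition first_tuple ::
    "nat \<Rightarrow> nat \<Rightarrow> state \<Rightarrow> nat list list \<Rightarrow> nat \<Rightarrow> nat \<Rightarrow> nat list option" where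
  "first_tuple n k \<alpha> Is u i = find (\<lambda>I. I ! u = i \<and> sector_norm n k \<alpha> I \<noteq> 0) Is"

definition is_leaf_encoder ::
    "nat \<Rightarrow> nat \<Rightarrow> nat \<Rightarrow> state \<Rightarrow> nat list list \<Rightarrow> nat \<Rightarrow> operator \<Rightarrow> bool" where
  "is_leaf_encoder n k l \<alpha> Is u U \<longleftrightarrow>
     unitary (leaf_size n k u) U \<and>
     (\<forall>i \<le> min l (leaf_size n k u). \<forall>I. first_tuple n k \<alpha> Is u i = Some I \<longrightarrow>
        (\<forall>y \<in> bitstrings (leaf_size n k u).
           U y (unary (leaf_size n k u) i) = (if hw y = i then leaf_coeff n k \<alpha> I u y else 0)))"


section \<open>The algorithm\<close>

text \<open>
  A circuit with \<open>a\<close> ancillas implements the algorithm if it consists of a circuit for every step of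
  the algorithm, one after the other.  The specifications of the blocks and of the leaf encoders fix
  only some of their columns; any unitaries satisfying them may be used.  Steps on disjoint qubits
  may still run in parallel, as \<^const>\<open>depth\<close> does not depend on the listed order of such gates.
\<close>

definition implements_algorithm ::
    "nat \<Rightarrow> nat \<Rightarrow> nat \<Rightarrow> state \<Rightarrow> nat list list \<Rightarrow> nat \<Rightarrow> circuit \<Rightarrow> bool" where
  "implements_algorithm n k l \<alpha> Is a C \<longleftrightarrow>
     (let vs = internal_nodes (partition_tree n k); G = num_leaves n k in
      \<exists>(B :: node \<Rightarrow> operator) (E :: nat \<Rightarrow> operator)
       (P :: circuit) (CB :: node \<Rightarrow> circuit) (CE :: nat \<Rightarrow> circuit).
        (\<forall>v \<in> set vs. is_gWDB n k \<alpha> v (B v)) \<and>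
        (\<forall>u < G. is_leaf_encoder n k l \<alpha> Is u (E u)) \<and>
        prepares n a (unary n l) P \<and>
        (\<forall>v \<in> set vs. realizes n a (node_qubits v) (B v) (CB v)) \<and>
        (\<forall>u < G. realizes n a (leaf n k u) (E u) (CE u)) \<and>
        C = P @ concat (map CB vs) @ concat (map CE [0..<G]))"

end

(*
  No ancilla is needed.  The basic gadget is a multiplexed Givens rotation in the span of 01 and 10
  of two qubits, with angles depending on c control qubits.  Conjugating a rotation by a controlled
  sign flip negates its angle, so halving the set of control values recursively gives O(2^c) gates.

  A generalized weight distribution block only ever meets the states "a ones at the end of the left
  child, b ones at the end of the right child".  For fixed a + b the required superposition is
  produced by a chain of rotations between (a, b) and (a + 1, b - 1), each controlled by the at most
  four neighbouring qubits.  The O(k^2) rotations act on windows of constant width and are scheduled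
  as a wavefront of O(k) slots.

  A leaf encoder fixes the output bits from left to right while the remaining weight stays in
  unary at the right end: bit p takes part of the amplitude of the leading one of the unary
  remainder, with angles depending on the bits already fixed.  Step p costs O((m - p) 2^p), in
  total O(2^m), and a final diagonal circuit supplies the phases.
*)
theory Submission
  imports Defs
begin

section \<open>Operators and circuits\<close>

text \<open>The blocks and encoders are prescribed on unary inputs only, so no given matrix has to
  be synthesised: \<open>circuit_op\<close> takes as operator whatever a circuit computes, unitarity
  is inherited from the gates, and just the prescribed columns are checked. One circuit must serve
  all weights j at once. It can, because the weight stays readable: in a leaf it is the weight of
  the fixed bits plus that of the unary remainder, in a weight distribution block it is a + b, which
  every rotation preserves. Controls of constant number suffice there because a unary string is
  monotone, so the neighbours of a position tell whether the boundary between zeros and ones lies at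
  it. The obstacle to linear depth is that the windows of a block overlap; it is met by the slots 3a
  + 4(k - b), whose coefficients are coprime and no smaller than the window width. Both claims are
  witnessed by one circuit, which leaves the ancillas alone.\<close>

lemma bitstrings_iff [simp]: "b \<in> bitstrings m \<longleftrightarrow> length b = m"
  by (simp add: bitstrings_def)

lemma finite_bitstrings [simp]: "finite (bitstrings m)"
  using finite_lists_length_eq[of "UNIV :: bool set" m] by (simp add: bitstrings_def)

lemma bitstrings_0: "bitstrings 0 = {[]}"
  by (auto simp: bitstrings_def)

lemma bitstrings_Suc: "bitstrings (Suc m) = (#) False ` bitstrings m \<union> (#) True ` bitstrings m"
proof -
  have "b \<in> (#) False ` bitstrings m \<union> (#) True ` bitstrings m" if "length b = Suc m" for b
  proof -
    from that obtain x c where "b = x # c" "length c = m" by (cases b) auto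
    then show ?thesis by (cases x) auto
  qed
  then have "bitstrings (Suc m) \<subseteq> (#) False ` bitstrings m \<union> (#) True ` bitstrings m"
    by (intro subsetI) (simp only: bitstrings_iff)
  then show ?thesis by (intro equalityI) auto
qed

lemma sum_bitstrings_0 [simp]: "(\<Sum>b\<in>bitstrings 0. f b) = f []"
  by (simp add: bitstrings_0)

lemma sum_bitstrings_Suc:
  "(\<Sum>b\<in>bitstrings (Suc m). f b) = (\<Sum>b\<in>bitstrings m. f (False # b)) + (\<Sum>b\<in>bitstrings m. f (True # b))"
  unfolding bitstrings_Suc by (subst sum.union_disjoint) (auto simp: sum.reindex)

lemma ball_bitstrings_Suc:
  "(\<forall>b\<in>bitstrings (Suc m). P b) \<longleftrightarrow> (\<forall>b\<in>bitstrings m. P (False # b)) \<and> (\<forall>b\<in>bitstrings m. P (True # b))"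
  unfolding bitstrings_Suc by auto

section \<open>Reading and overwriting bits at listed positions\<close>

lemma replace_bits_Nil [simp]: "replace_bits b [] g = b"
  by (simp add: replace_bits_def)

lemma replace_bits_Cons [simp]: "replace_bits b (p # ps) (x # g) = replace_bits (b[p := x]) ps g"
  by (simp add: replace_bits_def)

lemma replace_bits_Nil2 [simp]: "replace_bits b ps [] = b"
  by (simp add: replace_bits_def)

lemma length_replace_bits [simp]: "length (replace_bits b ps g) = length b"
proof (induction ps arbitrary: b g)
  case (Cons p ps)
  then show ?case by (cases g) auto
qed simp

lemma length_restrict_bits [simp]: "length (restrict_bits b ps) = length ps"
  by (simp add: restrict_bits_def)

lemma nth_restrict_bits [simp]: "j < length ps \<Longrightarrow> restrict_bits b ps ! j = b ! (ps ! j)"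
  by (simp add: restrict_bits_def)

lemma replace_bits_nth_other: "i \<notin> set ps \<Longrightarrow> replace_bits b ps g ! i = b ! i"
proof (induction ps arbitrary: b g)
  case (Cons p ps)
  then show ?case by (cases g) auto
qed simp

lemma replace_bits_nth:
  "\<lbrakk>distinct ps; set ps \<subseteq> {..<length b}; length g = length ps; j < length ps\<rbrakk>
    \<Longrightarrow> replace_bits b ps g ! (ps ! j) = g ! j"
proof (induction ps arbitrary: b g j)
  case (Cons p ps)
  then obtain x g' where g: "g = x # g'" by (cases g) auto
  show ?case
  proof (cases j)
    case 0
    then show ?thesis using Cons.prems g by (simp add: replace_bits_nth_other)
  next
    case (Suc j')
    have "set ps \<subseteq> {..<length (b[p := x])}" using Cons.prems by auto
    with Suc Cons.prems g show ?thesis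
      using Cons.IH[of "b[p := x]" g' j'] by auto
  qed
qed simp

lemma restrict_replace_bits [simp]:
  assumes "distinct ps" "set ps \<subseteq> {..<length b}" "length g = length ps"
  shows "restrict_bits (replace_bits b ps g) ps = g"
  using assms by (intro nth_equalityI) (auto simp: replace_bits_nth)

lemma bits_eqI:
  assumes "length b = length c" "restrict_bits b ps = restrict_bits c ps"
    "\<And>i. i < length b \<Longrightarrow> i \<notin> set ps \<Longrightarrow> b ! i = c ! i"
  shows "b = c"
proof (rule nth_equalityI)
  fix i assume i: "i < length b"
  show "b ! i = c ! i"
  proof (cases "i \<in> set ps")
    case True
    then obtain j where "j < length ps" "ps ! j = i" by (auto simp: in_set_conv_nth)
    then show ?thesis using assms(2) by (metis nth_restrict_bits)
  qed (use assms i in auto)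
qed (use assms in auto)

lemma replace_restrict_bits [simp]:
  assumes "distinct ps" "set ps \<subseteq> {..<length b}"
  shows "replace_bits b ps (restrict_bits b ps) = b"
  by (rule bits_eqI[of _ _ ps]) (use assms in \<open>auto simp: replace_bits_nth_other\<close>)

lemma replace_replace_bits [simp]:
  assumes "distinct ps" "set ps \<subseteq> {..<length b}" "length g = length ps" "length h = length ps"
  shows "replace_bits (replace_bits b ps g) ps h = replace_bits b ps h"
  by (rule bits_eqI[of _ _ ps]) (use assms in \<open>auto simp: replace_bits_nth_other\<close>)

lemma apply_on_cong:
  assumes "\<And>b'. length b' = length b \<Longrightarrow> \<phi> b' = \<psi> b'"
  shows "apply_on ps U \<phi> b = apply_on ps U \<psi> b"
  using assms by (simp add: apply_on_def)

lemma run_Nil [simp]: "run [] \<phi> = \<phi>"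
  by (simp add: run_def)

lemma run_Cons [simp]: "run (g # C) \<phi> = run C (apply_on (fst g) (snd g) \<phi>)"
  by (simp add: run_def case_prod_beta)

lemma run_append [simp]: "run (C @ D) \<phi> = run D (run C \<phi>)"
  by (simp add: run_def)

text \<open>Gates only look up strings of the length they are evaluated at. Facts known at one
  length can thus be propagated through a circuit, although a state also has values at all other
  lengths.\<close>

lemma run_cong:
  assumes "\<And>b'. length b' = length b \<Longrightarrow> \<phi> b' = \<psi> b'"
  shows "run C \<phi> b = run C \<psi> b"
  using assms
proof (induction C arbitrary: \<phi> \<psi>)
  case (Cons g C)
  show ?case by (simp, rule Cons.IH, rule apply_on_cong, rule Cons.prems) simp
qed simp

lemma apply_on_sum:
  "apply_on ps U (\<lambda>b. \<Sum>i\<in>A. f i * \<phi> i b) b = (\<Sum>i\<in>A. f i * apply_on ps U (\<phi> i) b)"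
  unfolding apply_on_def
  by (simp add: sum_distrib_left sum.swap[of _ A] mult_ac)

lemma run_sum: "run C (\<lambda>b. \<Sum>i\<in>A. f i * \<phi> i b) = (\<lambda>b. \<Sum>i\<in>A. f i * run C (\<phi> i) b)"
proof (induction C arbitrary: \<phi>)
  case (Cons g C)
  have "apply_on (fst g) (snd g) (\<lambda>b. \<Sum>i\<in>A. f i * \<phi> i b)
      = (\<lambda>b. \<Sum>i\<in>A. f i * apply_on (fst g) (snd g) (\<phi> i) b)"
    by (rule ext) (rule apply_on_sum)
  then show ?case by (simp add: Cons.IH)
qed simp

lemma run_add: "run C (\<lambda>b. x * \<phi> b + y * \<psi> b) = (\<lambda>b. x * run C \<phi> b + y * run C \<psi> b)"
  using run_sum[of C "\<lambda>i. if i then x else y" "\<lambda>i. if i then \<phi> else \<psi>" "UNIV :: bool set"]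
  by (simp add: UNIV_bool add_ac)

lemma run_ket_expand:
  assumes "length b = m"
  shows "run C \<phi> b = (\<Sum>y\<in>bitstrings m. \<phi> y * run C (ket y) b)"
proof -
  have "run C \<phi> b = run C (\<lambda>b. \<Sum>y\<in>bitstrings m. \<phi> y * ket y b) b"
  proof (rule run_cong)
    fix b' :: bits assume "length b' = length b"
    then have "b' \<in> bitstrings m" using assms by simp
    then show "\<phi> b' = (\<Sum>y\<in>bitstrings m. \<phi> y * ket y b')"
      using sum.delta[of "bitstrings m" b' \<phi>] finite_bitstrings[of m]
      by (simp add: ket_def if_distrib cong: if_cong)
  qed
  then show ?thesis by (simp add: run_sum)
qed

section \<open>Adjoints and unitarity of circuits\<close>

definition adj :: "operator \<Rightarrow> operator" where
  "adj U = (\<lambda>x y. cnj (U y x))"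

definition inverse_circuit :: "circuit \<Rightarrow> circuit" where
  "inverse_circuit C = rev (map (\<lambda>(ps, U). (ps, adj U)) C)"

definition inner :: "nat \<Rightarrow> state \<Rightarrow> state \<Rightarrow> complex" where
  "inner m \<phi> \<psi> = (\<Sum>b\<in>bitstrings m. cnj (\<phi> b) * \<psi> b)"

lemma adj_adj [simp]: "adj (adj U) = U"
  by (simp add: adj_def)

lemma unitary_adj: "unitary m U \<Longrightarrow> unitary m (adj U)"
  unfolding unitary_def adj_def by (auto simp: mult.commute)

lemma inner_apply_on:
  assumes ps: "distinct ps" "set ps \<subseteq> {..<m}"
  shows "inner m \<phi> (apply_on ps U \<psi>) = inner m (apply_on ps (adj U) \<phi>) \<psi>"
proof -
  let ?P = "bitstrings m \<times> bitstrings (length ps)"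
  let ?f = "\<lambda>(b, y). (replace_bits b ps y, restrict_bits b ps)"
  have "inner m \<phi> (apply_on ps U \<psi>)
      = (\<Sum>(b, y)\<in>?P. cnj (\<phi> b) * U (restrict_bits b ps) y * \<psi> (replace_bits b ps y))"
    by (simp add: inner_def apply_on_def sum_distrib_left sum.cartesian_product mult.assoc)
  \<comment> \<open>\<open>?f\<close> exchanges \<open>y\<close> with the bits of \<open>b\<close>
    at \<open>ps\<close>, so it is its own inverse.\<close>
  also have "\<dots> = (\<Sum>(b, y)\<in>?P. cnj (\<phi> (replace_bits b ps y)) * U y (restrict_bits b ps) * \<psi> b)"
    by (rule sum.reindex_bij_witness[of _ ?f ?f]) (use ps in auto)
  also have "\<dots> = inner m (apply_on ps (adj U) \<phi>) \<psi>"
    by (simp add: inner_def apply_on_def adj_def sum_distrib_right sum_distrib_left sum.cartesian_product mult_ac)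
  finally show ?thesis .
qed

lemma apply_on_adj:
  assumes ps: "distinct ps" "set ps \<subseteq> {..<length b}" and U: "unitary (length ps) U"
  shows "apply_on ps (adj U) (apply_on ps U \<phi>) b = \<phi> b"
proof -
  let ?B = "bitstrings (length ps)"
  have "apply_on ps (adj U) (apply_on ps U \<phi>) b
      = (\<Sum>y\<in>?B. \<Sum>z\<in>?B. cnj (U y (restrict_bits b ps)) * U y z * \<phi> (replace_bits b ps z))"
    unfolding apply_on_def adj_def using ps
    by (intro sum.cong refl) (simp add: sum_distrib_left mult.assoc)
  also have "\<dots> = (\<Sum>z\<in>?B. (\<Sum>y\<in>?B. cnj (U y (restrict_bits b ps)) * U y z) * \<phi> (replace_bits b ps z))"
    by (subst sum.swap) (simp add: sum_distrib_right)
  also have "\<dots> = (\<Sum>z\<in>?B. (if restrict_bits b ps = z then 1 else 0) * \<phi> (replace_bits b ps z))"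
    using U by (intro sum.cong refl) (simp add: unitary_def)
  also have "\<dots> = (\<Sum>z\<in>?B. if restrict_bits b ps = z then \<phi> (replace_bits b ps z) else 0)"
    by (intro sum.cong refl) simp
  also have "\<dots> = \<phi> b"
    using ps by (subst sum.delta') simp_all
  finally show ?thesis .
qed

lemma valid_circuit_Nil [simp]: "valid_circuit m []"
  by (simp add: valid_circuit_def)

lemma valid_circuit_Cons [simp]: "valid_circuit m (g # C) \<longleftrightarrow> valid_gate m g \<and> valid_circuit m C"
  by (simp add: valid_circuit_def)

lemma valid_circuit_append [simp]:
  "valid_circuit m (C @ D) \<longleftrightarrow> valid_circuit m C \<and> valid_circuit m D"
  by (auto simp: valid_circuit_def)

lemma inverse_circuit_simps [simp]:
  "inverse_circuit [] = []"
  "inverse_circuit (g # C) = inverse_circuit C @ [(fst g, adj (snd g))]"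
  by (simp_all add: inverse_circuit_def case_prod_beta)

lemma inverse_circuit_append: "inverse_circuit (C @ D) = inverse_circuit D @ inverse_circuit C"
  by (simp add: inverse_circuit_def)

lemma inverse_inverse_circuit [simp]: "inverse_circuit (inverse_circuit C) = C"
  by (induction C) (simp_all add: inverse_circuit_append)

lemma valid_inverse_circuit: "valid_circuit m C \<Longrightarrow> valid_circuit m (inverse_circuit C)"
  by (induction C) (auto simp: valid_gate_def unitary_adj)

lemma run_inverse:
  assumes "valid_circuit m C" "length b = m"
  shows "run (inverse_circuit C) (run C \<phi>) b = \<phi> b"
  using assms
proof (induction C arbitrary: \<phi> b)
  case (Cons g C)
  have "apply_on (fst g) (adj (snd g)) (run (inverse_circuit C) (run C (apply_on (fst g) (snd g) \<phi>))) b
      = apply_on (fst g) (adj (snd g)) (apply_on (fst g) (snd g) \<phi>) b"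
    by (rule apply_on_cong) (use Cons in auto)
  also have "\<dots> = \<phi> b"
    by (rule apply_on_adj) (use Cons.prems in \<open>auto simp: valid_gate_def\<close>)
  finally show ?case by simp
qed simp

lemma inner_run:
  assumes "valid_circuit m C"
  shows "inner m \<phi> (run C \<psi>) = inner m (run (inverse_circuit C) \<phi>) \<psi>"
  using assms
proof (induction C arbitrary: \<psi>)
  case (Cons g C)
  then show ?case by (auto simp: inner_apply_on valid_gate_def)
qed simp

lemma inner_ket:
  assumes "length x = m"
  shows "inner m (ket x) \<psi> = \<psi> x" and "inner m \<psi> (ket x) = cnj (\<psi> x)"
proof -
  have "inner m (ket x) \<psi> = (\<Sum>b\<in>bitstrings m. if b = x then \<psi> b else 0)"
    unfolding inner_def by (rule sum.cong) (auto simp: ket_def)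
  then show "inner m (ket x) \<psi> = \<psi> x" using assms by simp
  have "inner m \<psi> (ket x) = (\<Sum>b\<in>bitstrings m. if b = x then cnj (\<psi> b) else 0)"
    unfolding inner_def by (rule sum.cong) (auto simp: ket_def)
  then show "inner m \<psi> (ket x) = cnj (\<psi> x)" using assms by simp
qed

lemma inner_cong: "(\<And>b. length b = m \<Longrightarrow> \<psi> b = \<psi>' b) \<Longrightarrow> inner m \<phi> \<psi> = inner m \<phi> \<psi>'"
  by (simp add: inner_def)

lemma inner_run_run:
  assumes "valid_circuit m C"
  shows "inner m (run C \<phi>) (run C \<psi>) = inner m \<phi> \<psi>"
  using inner_run[OF valid_inverse_circuit[OF assms], of \<phi> "run C \<psi>"] run_inverse[OF assms]
  by (simp add: inner_cong[of m "run (inverse_circuit C) (run C \<psi>)" \<psi>])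

definition circuit_op :: "circuit \<Rightarrow> operator" where
  "circuit_op C = (\<lambda>x y. run C (ket y) x)"

lemma circuit_op_adj:
  assumes "valid_circuit m C" "length x = m" "length y = m"
  shows "circuit_op C x y = cnj (circuit_op (inverse_circuit C) y x)"
  using inner_run[OF assms(1), of "ket x" "ket y"] assms by (simp add: inner_ket circuit_op_def)

text \<open>Columns are orthonormal because \<open>run\<close> preserves \<open>inner\<close>; rows
  are, up to conjugation, columns of the inverse circuit. All blocks and encoders handed to the
  algorithm have this form, so their unitarity is never computed from entries.\<close>

lemma unitary_circuit_op:
  assumes "valid_circuit m C"
  shows "unitary m (circuit_op C)"
proof -
  have *: "(\<Sum>z\<in>bitstrings m. cnj (circuit_op D z x) * circuit_op D z y) = (if x = y then 1 else 0)"
    if "valid_circuit m D" "length x = m" "length y = m" for D x y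
  proof -
    have "inner m (run D (ket x)) (run D (ket y)) = (if x = y then 1 else 0)"
      using inner_run_run[OF that(1), of "ket x" "ket y"] that by (auto simp: inner_ket) (auto simp: ket_def)
    then show ?thesis by (simp add: circuit_op_def inner_def)
  qed
  have "(\<Sum>z\<in>bitstrings m. circuit_op C x z * cnj (circuit_op C y z)) = (if x = y then 1 else 0)"
    if "length x = m" "length y = m" for x y
  proof -
    have "(\<Sum>z\<in>bitstrings m. circuit_op C x z * cnj (circuit_op C y z))
        = (\<Sum>z\<in>bitstrings m. cnj (circuit_op (inverse_circuit C) z x) * circuit_op (inverse_circuit C) z y)"
      by (rule sum.cong) (use that assms in \<open>simp_all add: circuit_op_adj[of m C]\<close>)
    then show ?thesis using *[OF valid_inverse_circuit[OF assms] that] by simp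
  qed
  with * assms show ?thesis unfolding unitary_def by auto
qed

section \<open>Moving a circuit to other qubits\<close>

definition relabel :: "nat list \<Rightarrow> circuit \<Rightarrow> circuit" where
  "relabel ps = map (\<lambda>(qs, U). (map ((!) ps) qs, U))"

lemma relabel_simps [simp]:
  "relabel ps [] = []"
  "relabel ps (g # C) = (map ((!) ps) (fst g), snd g) # relabel ps C"
  by (simp_all add: relabel_def case_prod_beta)

lemma length_relabel [simp]: "length (relabel ps C) = length C"
  by (simp add: relabel_def)

lemma two_qubit_gates_le: "two_qubit_gates C \<le> length C"
  by (simp add: two_qubit_gates_def)

lemma valid_relabel:
  assumes "valid_circuit (length ps) C" "distinct ps" "set ps \<subseteq> {..<N}"
  shows "valid_circuit N (relabel ps C)"
  using assms(1)
proof (induction C)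
  case (Cons g C)
  have "inj_on ((!) ps) (set (fst g))"
    using Cons.prems assms(2) by (auto simp: valid_gate_def intro!: inj_on_nth)
  moreover have "(!) ps ` set (fst g) \<subseteq> {..<N}"
    using Cons.prems assms(3) by (force simp: valid_gate_def)
  ultimately show ?case using Cons by (auto simp: valid_gate_def distinct_map)
qed simp

lemma restrict_replace_map:
  assumes "distinct ps" "set ps \<subseteq> {..<length b}" "length z = length ps" "set qs \<subseteq> {..<length ps}"
  shows "restrict_bits (replace_bits b ps z) (map ((!) ps) qs) = restrict_bits z qs"
  using assms by (auto simp: restrict_bits_def replace_bits_nth)

lemma replace_replace_map:
  assumes "distinct ps" "set ps \<subseteq> {..<length b}" "length z = length ps" "set qs \<subseteq> {..<length ps}"
    "length y = length qs"
  shows "replace_bits (replace_bits b ps z) (map ((!) ps) qs) y = replace_bits b ps (replace_bits z qs y)"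
  using assms(3-5)
proof (induction qs arbitrary: y z)
  case (Cons q qs)
  then obtain e y' where y: "y = e # y'" by (cases y) auto
  have "(replace_bits b ps z)[ps ! q := e] = replace_bits b ps (z[q := e])"
  proof (rule bits_eqI[of _ _ ps])
    show "restrict_bits ((replace_bits b ps z)[ps ! q := e]) ps = restrict_bits (replace_bits b ps (z[q := e])) ps"
      using assms(1,2) Cons.prems
      by (intro nth_equalityI) (auto simp: replace_bits_nth nth_list_update nth_eq_iff_index_eq subset_iff)
  next
    fix i assume "i < length ((replace_bits b ps z)[ps ! q := e])" "i \<notin> set ps"
    moreover have "ps ! q \<in> set ps" using Cons.prems by auto
    ultimately show "(replace_bits b ps z)[ps ! q := e] ! i = replace_bits b ps (z[q := e]) ! i"
      by (metis nth_list_update_neq replace_bits_nth_other)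
  qed simp
  with Cons y show ?case by simp
qed simp

text \<open>Freeze the bits outside \<open>ps\<close> at those of \<open>b\<close>: the amplitudes,
  as a function of the bits on \<open>ps\<close>, form a state of the small register, and each
  relabelled gate acts on this slice as the original gate does.\<close>

lemma run_relabel_slice:
  assumes "valid_circuit (length ps) C" "distinct ps" "set ps \<subseteq> {..<length b}" "length z = length ps"
  shows "run (relabel ps C) \<phi> (replace_bits b ps z) = run C (\<lambda>z. \<phi> (replace_bits b ps z)) z"
  using assms(1)
proof (induction C arbitrary: \<phi>)
  case (Cons g C)
  have g: "set (fst g) \<subseteq> {..<length ps}" using Cons.prems by (auto simp: valid_gate_def)
  let ?g = "apply_on (map ((!) ps) (fst g)) (snd g) \<phi>"
  have "run (relabel ps (g # C)) \<phi> (replace_bits b ps z) = run C (\<lambda>z. ?g (replace_bits b ps z)) z"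
    using Cons by simp
  also have "\<dots> = run C (apply_on (fst g) (snd g) (\<lambda>z. \<phi> (replace_bits b ps z))) z"
  proof (rule run_cong)
    fix z' :: bits assume "length z' = length z"
    then show "?g (replace_bits b ps z') = apply_on (fst g) (snd g) (\<lambda>z. \<phi> (replace_bits b ps z)) z'"
      using assms g unfolding apply_on_def
      by (intro sum.cong) (simp_all add: restrict_replace_map replace_replace_map)
  qed
  finally show ?case by simp
qed simp

lemma run_relabel:
  assumes "valid_circuit (length ps) C" "distinct ps" "set ps \<subseteq> {..<length b}"
  shows "run (relabel ps C) \<phi> b = apply_on ps (circuit_op C) \<phi> b"
proof -
  let ?r = "restrict_bits b ps"
  have "run (relabel ps C) \<phi> b = run C (\<lambda>z. \<phi> (replace_bits b ps z)) ?r"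
    using run_relabel_slice[OF assms, of ?r \<phi>] assms by simp
  also have "\<dots> = (\<Sum>y\<in>bitstrings (length ps). \<phi> (replace_bits b ps y) * run C (ket y) ?r)"
    by (rule run_ket_expand) simp
  finally show ?thesis by (simp add: apply_on_def circuit_op_def mult.commute)
qed

text \<open>The relabelled gates touch main qubits only, so the equality holds on every state, for
  any number \<open>a\<close> of ancillas.\<close>

lemma realizes_relabel:
  assumes "valid_circuit (length ps) C" "distinct ps" "set ps \<subseteq> {..<n}"
  shows "realizes n a ps (circuit_op C) (relabel ps C)"
proof -
  have "set ps \<subseteq> {..<n + a}" using assms by auto
  then show ?thesis
    unfolding realizes_def using assms by (auto intro!: valid_relabel run_relabel)
qed


section \<open>Scheduling and elementary gates\<close>

text \<open>Depth relative to arbitrary start times. \<open>depth\<close> starts from an idle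
  register and does not compose; quantifying over \<open>t\<close> makes bounds add up in sequence,
  while circuits on disjoint qubits share a common bound.\<close>

definition fits :: "nat set \<Rightarrow> nat \<Rightarrow> circuit \<Rightarrow> bool" where
  "fits S d C \<longleftrightarrow> (\<forall>g\<in>set C. set (fst g) \<subseteq> S) \<and>
     (\<forall>t T. (\<forall>q\<in>S. t q \<le> T) \<longrightarrow> (\<forall>q\<in>S. fold schedule C t q \<le> T + d))"

lemma fitsD: "\<lbrakk>fits S d C; \<And>q. q \<in> S \<Longrightarrow> t q \<le> T; q \<in> S\<rbrakk> \<Longrightarrow> fold schedule C t q \<le> T + d"
  unfolding fits_def by blast

lemma fits_subset: "\<lbrakk>fits S d C; g \<in> set C\<rbrakk> \<Longrightarrow> set (fst g) \<subseteq> S"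
  unfolding fits_def by blast

lemma schedule_other: "q \<notin> set (fst g) \<Longrightarrow> schedule g t q = t q"
  by (cases g) (simp add: schedule_def)

lemma fold_schedule_other:
  assumes "\<forall>g\<in>set C. set (fst g) \<subseteq> S" "q \<notin> S"
  shows "fold schedule C t q = t q"
  using assms(1)
proof (induction C arbitrary: t)
  case (Cons g C)
  have "q \<notin> set (fst g)" using Cons.prems assms(2) by auto
  with Cons show ?case by (simp add: schedule_other)
qed simp

lemma fits_other: "\<lbrakk>fits S d C; q \<notin> S\<rbrakk> \<Longrightarrow> fold schedule C t q = t q"
  unfolding fits_def using fold_schedule_other by blast

lemma fits_Nil: "fits S d []"
  by (auto simp: fits_def intro: trans_le_add1)

lemma fits_append:
  assumes "fits S d C" "fits S e D"
  shows "fits S (d + e) (C @ D)"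
  unfolding fits_def
proof (intro conjI allI impI ballI)
  fix t :: "nat \<Rightarrow> nat" and T q assume t: "\<forall>q\<in>S. t q \<le> T" and q: "q \<in> S"
  have "fold schedule D (fold schedule C t) q \<le> (T + d) + e"
    by (rule fitsD[OF assms(2)]) (use fitsD[OF assms(1)] t q in auto)
  then show "fold schedule (C @ D) t q \<le> T + (d + e)" by (simp add: add.assoc)
qed (use assms in \<open>auto simp: fits_def\<close>)

lemma fits_mono:
  assumes "fits S d C" "S \<subseteq> S'" "d \<le> d'"
  shows "fits S' d' C"
  unfolding fits_def
proof (intro conjI allI impI ballI)
  fix t :: "nat \<Rightarrow> nat" and T q assume t: "\<forall>q\<in>S'. t q \<le> T" and q: "q \<in> S'"
  show "fold schedule C t q \<le> T + d'"
  proof (cases "q \<in> S")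
    case True
    then have "fold schedule C t q \<le> T + d" using fitsD[OF assms(1)] t assms(2) by blast
    then show ?thesis using assms(3) by simp
  next
    case False
    then show ?thesis using fits_other[OF assms(1), of q t] t q by (simp add: trans_le_add1)
  qed
next
  fix g assume "g \<in> set C"
  then show "set (fst g) \<subseteq> S'" using fits_subset[OF assms(1)] assms(2) by blast
qed

lemma fits_single:
  assumes "set ps \<subseteq> S"
  shows "fits S 1 [(ps, U)]"
  unfolding fits_def
proof (intro conjI allI impI ballI)
  fix t :: "nat \<Rightarrow> nat" and T q assume t: "\<forall>q\<in>S. t q \<le> T" and q: "q \<in> S"
  show "fold schedule [(ps, U)] t q \<le> T + 1"
  proof (cases "q \<in> set ps")
    case True
    then have "Max (t ` set ps) \<le> T" using t assms by (subst Max_le_iff) auto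
    then show ?thesis using True by (simp add: schedule_def)
  qed (use t q in \<open>auto simp: schedule_def le_SucI\<close>)
qed (use assms in auto)

lemma fits_length:
  assumes "\<forall>g\<in>set C. set (fst g) \<subseteq> S"
  shows "fits S (length C) C"
  using assms
proof (induction C)
  case (Cons g C)
  then have "fits S (1 + length C) ([(fst g, snd g)] @ C)"
    by (intro fits_append fits_single) auto
  then show ?case by simp
qed (simp add: fits_Nil)

lemma fits_par:
  assumes "fits S d C" "fits S' d D" "S \<inter> S' = {}"
  shows "fits (S \<union> S') d (C @ D)"
  unfolding fits_def
proof (intro conjI allI impI ballI)
  fix t :: "nat \<Rightarrow> nat" and T q assume t: "\<forall>q\<in>S \<union> S'. t q \<le> T" and q: "q \<in> S \<union> S'"
  show "fold schedule (C @ D) t q \<le> T + d"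
  proof (cases "q \<in> S'")
    case True
    have "fold schedule D (fold schedule C t) q \<le> T + d"
    proof (rule fitsD[OF assms(2) _ True])
      fix q' assume "q' \<in> S'"
      then have "fold schedule C t q' = t q'" using assms(3) by (intro fits_other[OF assms(1)]) auto
      then show "fold schedule C t q' \<le> T" using t \<open>q' \<in> S'\<close> by simp
    qed
    then show ?thesis by simp
  next
    case False
    then have "q \<in> S" using q by simp
    then show ?thesis using fits_other[OF assms(2) False] fitsD[OF assms(1), of t T q] t by simp
  qed
next
  fix g assume "g \<in> set (C @ D)"
  then consider "g \<in> set C" | "g \<in> set D" by auto
  then show "set (fst g) \<subseteq> S \<union> S'"
    by cases (use fits_subset[OF assms(1)] fits_subset[OF assms(2)] in blast)+
qed

lemma fits_concat_par:
  assumes "\<And>x. x \<in> set xs \<Longrightarrow> fits (S x) d (C x)" "distinct xs"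
    "\<And>x y. x \<in> set xs \<Longrightarrow> y \<in> set xs \<Longrightarrow> x \<noteq> y \<Longrightarrow> S x \<inter> S y = {}"
  shows "fits (\<Union>x\<in>set xs. S x) d (concat (map C xs))"
  using assms
proof (induction xs)
  case (Cons x xs)
  have "fits (S x \<union> (\<Union>x\<in>set xs. S x)) d (C x @ concat (map C xs))"
  proof (rule fits_par)
    show "S x \<inter> (\<Union>x\<in>set xs. S x) = {}" using Cons.prems(2,3) by fastforce
  qed (use Cons in auto)
  then show ?case by simp
qed (simp add: fits_Nil)

text \<open>
  Wavefront scheduling: if the block \<open>x\<close> is assigned the time slot \<open>f x\<close> and overlapping blocks are
  listed by increasing slots, the depth is governed by the number of slots, not of blocks.
\<close>

lemma fits_wavefront:
  assumes "\<And>x. x \<in> set xs \<Longrightarrow> fits (S x) d (C x)" "\<And>x. x \<in> set xs \<Longrightarrow> S x \<subseteq> A"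
    "\<And>x. x \<in> set xs \<Longrightarrow> f x < B"
    and sorted: "sorted_wrt (\<lambda>x y. S x \<inter> S y \<noteq> {} \<longrightarrow> f x < f y) xs"
  shows "fits A (d * B) (concat (map C xs))"
proof -
  \<comment> \<open>Strengthened to single qubits: the finishing time of \<open>q\<close> is
    governed by the slots of the blocks that touch \<open>q\<close>. A bound uniform over
    \<open>A\<close> could not be carried through the induction.\<close>
  have *: "fold schedule (concat (map C xs)) t q \<le> T + d * b"
    if "\<forall>q\<in>A. t q \<le> T" "q \<in> A" "\<forall>x\<in>set xs. q \<in> S x \<longrightarrow> f x < b" for t T b q
    using assms(1,2) sorted that
  proof (induction xs arbitrary: b q rule: rev_induct)
    case Nil
    then show ?case by (simp add: trans_le_add1)
  next
    case (snoc x xs)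
    let ?t = "fold schedule (concat (map C xs)) t"
    have IH: "?t q' \<le> T + d * b'" if "q' \<in> A" "\<forall>x\<in>set xs. q' \<in> S x \<longrightarrow> f x < b'" for q' b'
      by (rule snoc.IH) (use snoc.prems that in \<open>auto simp: sorted_wrt_append\<close>)
    have fx: "fits (S x) d (C x)" and Sx: "S x \<subseteq> A" using snoc.prems by auto
    show ?case
    proof (cases "q \<in> S x")
      case True
      \<comment> \<open>Earlier blocks that share a qubit with \<open>x\<close> lie in smaller
        slots, so every qubit of \<open>S x\<close> is free by time
        \<open>T + d * f x\<close>.\<close>
      have "fold schedule (C x) ?t q \<le> (T + d * f x) + d"
      proof (rule fitsD[OF fx _ True])
        fix q' assume q': "q' \<in> S x"
        then have "\<forall>y\<in>set xs. q' \<in> S y \<longrightarrow> f y < f x"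
          using snoc.prems(3) by (auto simp: sorted_wrt_append)
        then show "?t q' \<le> T + d * f x" using IH q' Sx by blast
      qed
      also have "\<dots> = T + d * Suc (f x)" by simp
      also have "\<dots> \<le> T + d * b"
        using snoc.prems(6) True by (intro add_mono mult_le_mono) auto
      finally show ?thesis by simp
    next
      case False
      then show ?thesis using IH[of q b] snoc.prems(5,6) fits_other[OF fx False] by simp
    qed
  qed
  show ?thesis unfolding fits_def
  proof (intro conjI allI impI ballI)
    fix g assume "g \<in> set (concat (map C xs))"
    then obtain x where "x \<in> set xs" "g \<in> set (C x)" by auto
    then show "set (fst g) \<subseteq> A" using fits_subset[OF assms(1)] assms(2) by blast
  next
    fix t :: "nat \<Rightarrow> nat" and T q assume "\<forall>q\<in>A. t q \<le> T" "q \<in> A"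
    then show "fold schedule (concat (map C xs)) t q \<le> T + d * B" using * assms(3) by blast
  qed
qed

lemma fold_schedule_cong:
  assumes "\<forall>g\<in>set C. set (fst g) \<subseteq> S" "\<And>i. i \<in> S \<Longrightarrow> t i = t' i" "q \<in> S"
  shows "fold schedule C t q = fold schedule C t' q"
  using assms
proof (induction C arbitrary: t t')
  case (Cons g C)
  have "t ` set (fst g) = t' ` set (fst g)" using Cons.prems by (intro image_cong) auto
  then have "schedule g t i = schedule g t' i" if "i \<in> S" for i
    using Cons.prems(2) that by (cases g) (simp add: schedule_def)
  then have "fold schedule C (schedule g t) q = fold schedule C (schedule g t') q"
    using Cons.prems by (intro Cons.IH) auto
  then show ?case by simp
qed simp

lemma fold_schedule_relabel:
  assumes "distinct ps" "\<forall>g\<in>set C. set (fst g) \<subseteq> {..<length ps}" "q < length ps"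
  shows "fold schedule (relabel ps C) t (ps ! q) = fold schedule C (\<lambda>i. t (ps ! i)) q"
  using assms(2)
proof (induction C arbitrary: t)
  case (Cons g C)
  obtain qs U where g: "g = (qs, U)" by (cases g)
  have *: "schedule (map ((!) ps) qs, U) t (ps ! i) = schedule g (\<lambda>i. t (ps ! i)) i" if "i < length ps" for i
  proof -
    have "ps ! i \<in> (!) ps ` set qs \<longleftrightarrow> i \<in> set qs"
      using Cons.prems that assms(1) g by (auto simp: nth_eq_iff_index_eq subset_iff)
    then show ?thesis using g by (simp add: schedule_def image_image)
  qed
  have "fold schedule (relabel ps (g # C)) t (ps ! q)
      = fold schedule C (\<lambda>i. schedule (map ((!) ps) qs, U) t (ps ! i)) q"
    using Cons g by simp
  also have "\<dots> = fold schedule C (schedule g (\<lambda>i. t (ps ! i))) q"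
    by (rule fold_schedule_cong[of _ "{..<length ps}"]) (use Cons.prems * assms(3) in auto)
  finally show ?case by simp
qed simp

lemma fits_relabel:
  assumes "fits {..<length ps} d C" "distinct ps"
  shows "fits (set ps) d (relabel ps C)"
  unfolding fits_def
proof (intro conjI allI impI ballI)
  fix g assume "g \<in> set (relabel ps C)"
  then obtain h where "h \<in> set C" "fst g = map ((!) ps) (fst h)"
    by (auto simp: relabel_def)
  then show "set (fst g) \<subseteq> set ps" using fits_subset[OF assms(1), of h] by auto
next
  fix t :: "nat \<Rightarrow> nat" and T q assume t: "\<forall>q\<in>set ps. t q \<le> T" and "q \<in> set ps"
  then obtain i where i: "i < length ps" "q = ps ! i" by (auto simp: in_set_conv_nth)
  have "fold schedule C (\<lambda>i. t (ps ! i)) i \<le> T + d"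
    by (rule fitsD[OF assms(1)]) (use t i in auto)
  moreover have "\<forall>g\<in>set C. set (fst g) \<subseteq> {..<length ps}" using assms(1) by (simp add: fits_def)
  ultimately show "fold schedule (relabel ps C) t q \<le> T + d"
    using i fold_schedule_relabel[OF assms(2)] by simp
qed

lemma depth_le:
  assumes "fits {..<N} d C" "0 < N"
  shows "depth N C \<le> d"
proof -
  have "busy C q \<le> d" if "q < N" for q
    using fitsD[OF assms(1), of "\<lambda>_. 0" 0 q] that by (simp add: busy_def)
  then show ?thesis using assms(2) unfolding depth_def by (subst Max_le_iff) auto
qed

section \<open>Elementary gates and their action on amplitudes\<close>

definition givens :: "real \<Rightarrow> operator" where
  "givens \<theta> = (\<lambda>x y. if x ! 0 = x ! 1 then (if y = x then 1 else 0)
     else if y = x then complex_of_real (cos \<theta>)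
     else if y = [x ! 1, x ! 0] then (if x ! 0 then 1 else - 1) * complex_of_real (sin \<theta>) else 0)"

definition cz :: operator where
  "cz = (\<lambda>x y. if x = y then (if x = [True, True] then - 1 else 1) else 0)"

definition cnot :: operator where
  "cnot = (\<lambda>x y. if y = [x ! 0, x ! 0 \<noteq> x ! 1] then 1 else 0)"

definition pauli_x :: operator where
  "pauli_x = (\<lambda>x y. if y = [\<not> x ! 0] then 1 else 0)"

definition phase_gate :: "real \<Rightarrow> real \<Rightarrow> operator" where
  "phase_gate s t = (\<lambda>x y. if x = y then cis (if x ! 0 then t else s) else 0)"

lemma sum_bitstrings_1: "(\<Sum>b\<in>bitstrings (Suc 0). f b) = f [False] + f [True]"
  by (simp add: sum_bitstrings_Suc)

lemma sum_bitstrings_2: "(\<Sum>b\<in>bitstrings 2. f b)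
  = f [False, False] + f [False, True] + (f [True, False] + f [True, True])"
  by (simp add: numeral_2_eq_2 sum_bitstrings_Suc)

lemma ball_bitstrings_2: "(\<forall>b\<in>bitstrings 2. P b)
  \<longleftrightarrow> P [False, False] \<and> P [False, True] \<and> P [True, False] \<and> P [True, True]"
  by (auto simp: numeral_2_eq_2 ball_bitstrings_Suc bitstrings_0 simp del: bitstrings_iff)

lemma ball_bitstrings_1: "(\<forall>b\<in>bitstrings (Suc 0). P b) \<longleftrightarrow> P [False] \<and> P [True]"
  by (auto simp: ball_bitstrings_Suc bitstrings_0 simp del: bitstrings_iff)

lemma cos_sin_of_real: "complex_of_real (cos \<theta>) * complex_of_real (cos \<theta>) + complex_of_real (sin \<theta>) * complex_of_real (sin \<theta>) = 1"
  by (metis of_real_1 of_real_add of_real_mult sin_cos_squared_add3)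

lemma unitary_givens: "unitary 2 (givens \<theta>)"
  unfolding unitary_def ball_bitstrings_2 sum_bitstrings_2 givens_def
  using cos_sin_of_real[of \<theta>] by (simp add: add.commute)

lemma unitary_cz: "unitary 2 cz"
  unfolding unitary_def ball_bitstrings_2 sum_bitstrings_2 cz_def by simp

lemma unitary_cnot: "unitary 2 cnot"
  unfolding unitary_def ball_bitstrings_2 sum_bitstrings_2 cnot_def by simp

lemma unitary_pauli_x: "unitary (Suc 0) pauli_x"
  unfolding unitary_def ball_bitstrings_1 sum_bitstrings_1 pauli_x_def by simp

lemma unitary_phase_gate: "unitary (Suc 0) (phase_gate s t)"
  unfolding unitary_def ball_bitstrings_1 sum_bitstrings_1 phase_gate_def
  by (simp add: cis_mult cis_cnj)

lemma apply_on_pair: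
  "apply_on [p, q] U \<phi> b = U [b ! p, b ! q] [False, False] * \<phi> (b[p := False, q := False])
     + U [b ! p, b ! q] [False, True] * \<phi> (b[p := False, q := True])
     + (U [b ! p, b ! q] [True, False] * \<phi> (b[p := True, q := False])
     + U [b ! p, b ! q] [True, True] * \<phi> (b[p := True, q := True]))"
proof -
  have "length [p, q] = 2" by simp
  then show ?thesis unfolding apply_on_def by (simp only: sum_bitstrings_2) (simp add: restrict_bits_def)
qed

lemma apply_on_one:
  "apply_on [p] U \<phi> b = U [b ! p] [False] * \<phi> (b[p := False]) + U [b ! p] [True] * \<phi> (b[p := True])"
  unfolding apply_on_def by (simp add: restrict_bits_def sum_bitstrings_1)

definition swap_bits :: "nat \<Rightarrow> nat \<Rightarrow> bits \<Rightarrow> bits" where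
  "swap_bits p q b = b[p := b ! q, q := b ! p]"

lemma update_same: "\<lbrakk>b ! p = x; b ! q = y\<rbrakk> \<Longrightarrow> b[p := x, q := y] = b"
  by auto

lemma apply_givens:
  "apply_on [p, q] (givens \<theta>) \<phi> b = (if b ! p = b ! q then \<phi> b else
     complex_of_real (cos \<theta>) * \<phi> b + (if b ! p then 1 else - 1) * complex_of_real (sin \<theta>) * \<phi> (swap_bits p q b))"
  using update_same[of b p "b ! p" q "b ! q"]
  by (cases "b ! p"; cases "b ! q") (simp_all add: apply_on_pair givens_def swap_bits_def)

lemma apply_cz:
  "apply_on [p, q] cz \<phi> b = (if b ! p \<and> b ! q then - \<phi> b else \<phi> b)"
  using update_same[of b p "b ! p" q "b ! q"]
  by (cases "b ! p"; cases "b ! q") (simp_all add: apply_on_pair cz_def)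

lemma apply_cnot:
  "apply_on [p, q] cnot \<phi> b = \<phi> (b[q := (b ! p \<noteq> b ! q)])"
proof -
  have "b ! p = x \<Longrightarrow> b[p := x] = b" for x by (drule sym) (simp only: list_update_id)
  then show ?thesis
    by (cases "b ! p"; cases "b ! q") (simp_all add: apply_on_pair cnot_def)
qed

lemma apply_pauli_x: "apply_on [p] pauli_x \<phi> b = \<phi> (b[p := (\<not> b ! p)])"
  by (cases "b ! p") (simp_all add: apply_on_one pauli_x_def)

lemma apply_phase_gate: "apply_on [p] (phase_gate s t) \<phi> b = cis (if b ! p then t else s) * \<phi> b"
proof -
  have "b ! p = x \<Longrightarrow> b[p := x] = b" for x by (drule sym) (simp only: list_update_id)
  then show ?thesis by (cases "b ! p") (simp_all add: apply_on_one phase_gate_def)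
qed


section \<open>Multiplexed rotations\<close>

text \<open>Let u be the half-sum and v the half-difference of the angles for the two values of
  \<open>c\<close>. The first half turns by u; the second, conjugated by the flip, by v or -v. This
  gives u + v = \<open>\<theta> (False # x)\<close> and u - v = \<open>\<theta> (True # x)\<close>.
  Rotation \<open>W\<close> and flip \<open>F\<close> are parameters so that amplitudes and phases
  share the construction.\<close>

fun mux :: "(real \<Rightarrow> gate) \<Rightarrow> (nat \<Rightarrow> gate) \<Rightarrow> nat list \<Rightarrow> (bits \<Rightarrow> real) \<Rightarrow> circuit" where
  "mux W F [] \<theta> = [W (\<theta> [])]"
| "mux W F (c # cs) \<theta> =
     mux W F cs (\<lambda>x. (\<theta> (False # x) + \<theta> (True # x)) / 2) @ [F c] @
     mux W F cs (\<lambda>x. (\<theta> (False # x) - \<theta> (True # x)) / 2) @ [F c]"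

text \<open>The count solves L(c + 1) = 2 L(c) + 2 with L(0) = 1, i.e. L(c) = 3 * 2^c - 2.\<close>

lemma length_mux: "length (mux W F cs \<theta>) + 2 = 3 * 2 ^ length cs"
proof (induction cs arbitrary: \<theta>)
  case (Cons c cs)
  show ?case using Cons[of "\<lambda>x. (\<theta> (False # x) + \<theta> (True # x)) / 2"]
    Cons[of "\<lambda>x. (\<theta> (False # x) - \<theta> (True # x)) / 2"] by simp
qed simp

lemma set_mux: "set (mux W F cs \<theta>) \<subseteq> range W \<union> F ` set cs"
  by (induction cs arbitrary: \<theta>) auto

text \<open>If \<open>c\<close> is set, \<open>cz\<close> negates the amplitudes with
  \<open>p\<close> set, so conjugation by it negates the off-diagonal entries of the
  rotation.\<close>

definition givens_mux :: "nat \<Rightarrow> nat \<Rightarrow> nat list \<Rightarrow> (bits \<Rightarrow> real) \<Rightarrow> circuit" where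
  "givens_mux p q = mux (\<lambda>\<theta>. ([p, q], givens \<theta>)) (\<lambda>c. ([c, p], cz))"

text \<open>The two phases are opposite, so exchanging them by a \<open>cnot\<close> amounts to
  negating the angle.\<close>

definition phase_mux :: "nat \<Rightarrow> nat list \<Rightarrow> (bits \<Rightarrow> real) \<Rightarrow> circuit" where
  "phase_mux q = mux (\<lambda>\<theta>. ([q], phase_gate \<theta> (- \<theta>))) (\<lambda>c. ([c, q], cnot))"

lemma length_givens_mux: "length (givens_mux p q cs \<theta>) \<le> 3 * 2 ^ length cs"
  using length_mux[of "\<lambda>\<theta>. ([p, q], givens \<theta>)" "\<lambda>c. ([c, p], cz)" cs \<theta>] by (simp add: givens_mux_def)

lemma length_phase_mux: "length (phase_mux q cs \<theta>) \<le> 3 * 2 ^ length cs"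
  using length_mux[of "\<lambda>\<theta>. ([q], phase_gate \<theta> (- \<theta>))" "\<lambda>c. ([c, q], cnot)" cs \<theta>]
  by (simp add: phase_mux_def)

lemma valid_circuitI: "(\<And>g. g \<in> set C \<Longrightarrow> valid_gate N g) \<Longrightarrow> valid_circuit N C"
  by (simp add: valid_circuit_def)

lemma valid_givens_mux:
  assumes "distinct (p # q # cs)" "set (p # q # cs) \<subseteq> {..<N}"
  shows "valid_circuit N (givens_mux p q cs \<theta>)"
proof (rule valid_circuitI)
  fix g assume "g \<in> set (givens_mux p q cs \<theta>)"
  then have "g \<in> range (\<lambda>\<theta>. ([p, q], givens \<theta>)) \<union> (\<lambda>c. ([c, p], cz)) ` set cs"
    using set_mux unfolding givens_mux_def by blast
  then show "valid_gate N g"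
    using assms by (auto simp: valid_gate_def unitary_givens unitary_cz numeral_2_eq_2[symmetric])
qed

lemma valid_phase_mux:
  assumes "distinct (q # cs)" "set (q # cs) \<subseteq> {..<N}"
  shows "valid_circuit N (phase_mux q cs \<theta>)"
proof (rule valid_circuitI)
  fix g assume "g \<in> set (phase_mux q cs \<theta>)"
  then have "g \<in> range (\<lambda>\<theta>. ([q], phase_gate \<theta> (- \<theta>))) \<union> (\<lambda>c. ([c, q], cnot)) ` set cs"
    using set_mux unfolding phase_mux_def by blast
  then show "valid_gate N g"
    using assms by (auto simp: valid_gate_def unitary_phase_gate unitary_cnot numeral_2_eq_2[symmetric])
qed

lemma qubits_givens_mux: "g \<in> set (givens_mux p q cs \<theta>) \<Longrightarrow> set (fst g) \<subseteq> set (p # q # cs)"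
  using set_mux[of "\<lambda>\<theta>. ([p, q], givens \<theta>)" "\<lambda>c. ([c, p], cz)" cs \<theta>] unfolding givens_mux_def by force

lemma length_swap_bits [simp]: "length (swap_bits p q b) = length b"
  by (simp add: swap_bits_def)

lemma nth_swap_bits:
  "\<lbrakk>p < length b; q < length b\<rbrakk> \<Longrightarrow>
    swap_bits p q b ! i = (if i = q then b ! p else if i = p then b ! q else b ! i)"
  by (auto simp: swap_bits_def nth_list_update)

lemma swap_swap_bits [simp]: "\<lbrakk>p < length b; q < length b\<rbrakk> \<Longrightarrow> swap_bits p q (swap_bits p q b) = b"
  by (intro nth_equalityI) (auto simp: nth_swap_bits)

lemma restrict_swap_bits [simp]:
  "\<lbrakk>p < length b; q < length b; p \<notin> set cs; q \<notin> set cs\<rbrakk> \<Longrightarrow>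
    restrict_bits (swap_bits p q b) cs = restrict_bits b cs"
  by (auto simp: restrict_bits_def nth_swap_bits)

lemma run_givens_mux:
  assumes "distinct (p # q # cs)" "set (p # q # cs) \<subseteq> {..<length b}"
  shows "run (givens_mux p q cs \<theta>) \<phi> b = (if b ! p = b ! q then \<phi> b else
     complex_of_real (cos (\<theta> (restrict_bits b cs))) * \<phi> b +
     (if b ! p then 1 else - 1) * complex_of_real (sin (\<theta> (restrict_bits b cs))) * \<phi> (swap_bits p q b))"
  using assms
proof (induction cs arbitrary: \<theta> \<phi> b)
  case Nil
  then show ?case by (simp add: givens_mux_def apply_givens restrict_bits_def)
next
  case (Cons c cs)
  let ?f = "\<lambda>x. (\<theta> (False # x) + \<theta> (True # x)) / 2" and ?g = "\<lambda>x. (\<theta> (False # x) - \<theta> (True # x)) / 2"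
  let ?r = "restrict_bits b cs"
  define u v where "u = ?f ?r" and "v = ?g ?r"
  have eq: "givens_mux p q (c # cs) \<theta> = givens_mux p q cs ?f @ [([c, p], cz)] @ givens_mux p q cs ?g @ [([c, p], cz)]"
    by (simp add: givens_mux_def)
  have IH: "run (givens_mux p q cs \<theta>') \<psi> b' = (if b' ! p = b' ! q then \<psi> b' else
     complex_of_real (cos (\<theta>' ?r)) * \<psi> b' +
     (if b' ! p then 1 else - 1) * complex_of_real (sin (\<theta>' ?r)) * \<psi> (swap_bits p q b'))"
    if "length b' = length b" "restrict_bits b' cs = ?r" for \<theta>' \<psi> b'
    unfolding that(2)[symmetric] by (rule Cons.IH) (use Cons.prems that in auto)
  note F = IH[of _ ?f, folded u_def] and G = IH[of _ ?g, folded v_def]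
  have r: "restrict_bits b (c # cs) = b ! c # ?r" by (simp add: restrict_bits_def)
  have pq: "p < length b" "q < length b" "c \<noteq> p" "c \<noteq> q" "p \<noteq> q" "p \<notin> set cs" "q \<notin> set cs"
    using Cons.prems by auto
  have t: "\<theta> (b ! c # ?r) = (if b ! c then u - v else u + v)"
    by (simp add: u_def v_def field_simps)
  show ?case
  proof (cases "b ! p = b ! q")
    case True
    then show ?thesis unfolding eq by (simp add: apply_cz F G)
  next
    case False
    define s where "s = swap_bits p q b"
    define e :: complex where "e = (if b ! p then 1 else - 1)"
    define \<psi> \<chi> where "\<psi> = run (givens_mux p q cs ?f) \<phi>" and "\<chi> = apply_on [c, p] cz \<psi>"
    have s: "length s = length b" "restrict_bits s cs = ?r" "s ! p = b ! q" "s ! q = b ! p" "s ! c = b ! c"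
      "swap_bits p q s = b" "s ! p \<noteq> s ! q"
      using pq False by (simp_all add: s_def nth_swap_bits)
    have e: "e * e = 1" by (simp add: e_def)
    have "(if s ! p then 1 else - 1) = - e" using s(3) False by (simp add: e_def)
    then have \<psi>: "\<psi> b = cos u * \<phi> b + e * sin u * \<phi> s" "\<psi> s = cos u * \<phi> s - e * sin u * \<phi> b"
      using F[of b \<phi>] F[of s \<phi>] s False by (simp_all add: \<psi>_def e_def[symmetric] s_def[symmetric])
    have \<chi>: "\<chi> b = (if b ! c \<and> b ! p then - \<psi> b else \<psi> b)" "\<chi> s = (if b ! c \<and> \<not> b ! p then - \<psi> s else \<psi> s)"
      using s False by (auto simp: \<chi>_def apply_cz)
    have "run (givens_mux p q (c # cs) \<theta>) \<phi> b
        = apply_on [c, p] cz (run (givens_mux p q cs ?g) \<chi>) b"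
      by (simp add: eq \<chi>_def \<psi>_def)
    also have "\<dots> = (if b ! c \<and> b ! p then - 1 else 1) * (cos v * \<chi> b + e * sin v * \<chi> s)"
      using G[of b \<chi>] False by (simp add: apply_cz e_def s_def)
    \<comment> \<open>On the diagonal term the signs of the two \<open>cz\<close> gates cancel.
      Exactly one of \<open>b\<close> and \<open>s\<close> has bit \<open>p\<close> set, so the
      cross term keeps one minus sign.\<close>
    also have "\<dots> = (if b ! c then cos v * \<psi> b - e * sin v * \<psi> s else cos v * \<psi> b + e * sin v * \<psi> s)"
      by (simp add: \<chi>)
    also have "\<dots> = cos (if b ! c then u - v else u + v) * \<phi> b + e * sin (if b ! c then u - v else u + v) * \<phi> s"
    proof -
      have e': "e * (e * z) = z" for z using e by (simp add: mult.assoc[symmetric])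
      show ?thesis
        by (simp add: \<psi> cos_add sin_add cos_diff sin_diff distrib_left distrib_right
            left_diff_distrib right_diff_distrib mult_ac e')
    qed
    finally show ?thesis using False by (simp add: r t e_def s_def)
  qed
qed

lemma cis_mult_left: "cis a * (cis b * z) = cis (a + b) * z"
  by (simp add: cis_mult[symmetric])

lemma run_phase_mux:
  assumes "distinct (q # cs)" "set (q # cs) \<subseteq> {..<length b}"
  shows "run (phase_mux q cs \<theta>) \<phi> b = cis (if b ! q then - \<theta> (restrict_bits b cs) else \<theta> (restrict_bits b cs)) * \<phi> b"
  using assms
proof (induction cs arbitrary: \<theta> \<phi> b)
  case Nil
  then show ?case by (simp add: phase_mux_def apply_phase_gate restrict_bits_def)
next
  case (Cons c cs)
  let ?f = "\<lambda>x. (\<theta> (False # x) + \<theta> (True # x)) / 2" and ?g = "\<lambda>x. (\<theta> (False # x) - \<theta> (True # x)) / 2"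
  let ?r = "restrict_bits b cs"
  have eq: "phase_mux q (c # cs) \<theta> = phase_mux q cs ?f @ [([c, q], cnot)] @ phase_mux q cs ?g @ [([c, q], cnot)]"
    by (simp add: phase_mux_def)
  have IH: "run (phase_mux q cs \<theta>') \<psi> b' =
      cis (if b' ! q then - \<theta>' (restrict_bits b' cs) else \<theta>' (restrict_bits b' cs)) * \<psi> b'"
    if "length b' = length b" for \<theta>' \<psi> b'
    by (rule Cons.IH) (use Cons.prems that in auto)
  have r: "restrict_bits b (c # cs) = b ! c # ?r" by (simp add: restrict_bits_def)
  \<comment> \<open>The string at which the last \<open>cnot\<close> looks up the amplitude for
    \<open>b\<close>; the earlier \<open>cnot\<close> leads back from it to
    \<open>b\<close>.\<close>
  define b1 where "b1 = b[q := (b ! c \<noteq> b ! q)]"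
  have q: "q < length b" "c \<noteq> q" "q \<notin> set cs" using Cons.prems by auto
  have b1: "length b1 = length b" "b1 ! q = (b ! c \<noteq> b ! q)" "b1[q := (b1 ! c \<noteq> b1 ! q)] = b"
  proof -
    have "(b1 ! c \<noteq> b1 ! q) = b ! q" using q by (auto simp: b1_def)
    then have "b1[q := (b1 ! c \<noteq> b1 ! q)] = b[q := b ! q]" by (simp only: b1_def list_update_overwrite)
    then show "b1[q := (b1 ! c \<noteq> b1 ! q)] = b" by simp
  qed (use q in \<open>simp_all add: b1_def\<close>)
  have r1: "restrict_bits b1 cs = ?r"
    using q by (auto simp: b1_def restrict_bits_def nth_list_update)
  define \<chi> where "\<chi> = apply_on [c, q] cnot (run (phase_mux q cs ?f) \<phi>)"
  have "\<chi> b1 = run (phase_mux q cs ?f) \<phi> b"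
    by (simp only: \<chi>_def apply_cnot b1(3))
  then have \<chi>: "\<chi> b1 = cis (if b ! q then - ?f ?r else ?f ?r) * \<phi> b"
    by (simp only: IH)
  have "run (phase_mux q (c # cs) \<theta>) \<phi> b = apply_on [c, q] cnot (run (phase_mux q cs ?g) \<chi>) b"
    by (simp add: eq \<chi>_def)
  also have "\<dots> = run (phase_mux q cs ?g) \<chi> b1"
    by (simp only: apply_cnot b1_def)
  also have "\<dots> = cis (if b1 ! q then - ?g ?r else ?g ?r) * (cis (if b ! q then - ?f ?r else ?f ?r) * \<phi> b)"
    by (simp only: IH[OF b1(1)] r1 \<chi>)
  also have "\<dots> = cis (if b ! q then - \<theta> (b ! c # ?r) else \<theta> (b ! c # ?r)) * \<phi> b"
    unfolding b1(2) by (cases "b ! c"; cases "b ! q") (simp_all add: cis_mult_left add_divide_distrib diff_divide_distrib)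
  finally show ?case by (simp add: r)
qed

text \<open>The phase is split into a part odd under flipping \<open>q\<close>, which is a
  multiplexed phase, and an even part, which no longer depends on \<open>q\<close>. The global phase
  that remains at the end is put on qubit 0.\<close>

fun diag_circuit :: "nat list \<Rightarrow> (bits \<Rightarrow> real) \<Rightarrow> circuit" where
  "diag_circuit [] \<theta> = [([0], phase_gate (\<theta> []) (\<theta> []))]"
| "diag_circuit (q # cs) \<theta> = phase_mux q cs (\<lambda>x. (\<theta> (False # x) - \<theta> (True # x)) / 2) @
     diag_circuit cs (\<lambda>x. (\<theta> (False # x) + \<theta> (True # x)) / 2)"

lemma valid_diag_circuit:
  assumes "distinct cs" "set cs \<subseteq> {..<N}" "0 < N"
  shows "valid_circuit N (diag_circuit cs \<theta>)"
  using assms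
  by (induction cs arbitrary: \<theta>) (auto simp: valid_phase_mux valid_gate_def unitary_phase_gate)

lemma length_diag_circuit: "length (diag_circuit cs \<theta>) \<le> 3 * 2 ^ length cs"
proof (induction cs arbitrary: \<theta>)
  case (Cons c cs)
  show ?case
    using add_mono[OF length_phase_mux[of c cs "\<lambda>x. (\<theta> (False # x) - \<theta> (True # x)) / 2"]
      Cons[of "\<lambda>x. (\<theta> (False # x) + \<theta> (True # x)) / 2"]] by simp
qed simp

lemma run_diag_circuit:
  assumes "distinct cs" "set cs \<subseteq> {..<length b}"
  shows "run (diag_circuit cs \<theta>) \<phi> b = cis (\<theta> (restrict_bits b cs)) * \<phi> b"
  using assms
proof (induction cs arbitrary: \<theta> \<phi>)
  case Nil
  then show ?case by (simp add: apply_phase_gate restrict_bits_def)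
next
  case (Cons c cs)
  have r: "restrict_bits b (c # cs) = b ! c # restrict_bits b cs" by (simp add: restrict_bits_def)
  show ?case unfolding r using Cons
    by (cases "b ! c")
      (simp_all add: run_phase_mux cis_mult_left add_divide_distrib diff_divide_distrib)
qed

text \<open>Truncation to length \<open>N\<close> lets an output be equated, as a function, with a
  superposition of kets and then be fed into the next circuit.\<close>

definition ev :: "nat \<Rightarrow> circuit \<Rightarrow> state \<Rightarrow> state" where
  "ev N C \<phi> = (\<lambda>b. if length b = N then run C \<phi> b else 0)"

lemma ev_append: "ev N (C @ D) \<phi> = ev N D (ev N C \<phi>)"
  unfolding ev_def by (rule ext) (simp, intro impI run_cong, simp)

lemma ev_Nil_ket [simp]: "length x = N \<Longrightarrow> ev N [] (ket x) = ket x"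
  by (auto simp: ev_def ket_def)

lemma ev_add: "ev N C (\<lambda>b. x * \<phi> b + y * \<psi> b) = (\<lambda>b. x * ev N C \<phi> b + y * ev N C \<psi> b)"
  by (auto simp: ev_def run_add)

lemma ev_fixed:
  assumes "length x = N" "\<And>y. y \<in> set ys \<Longrightarrow> ev N (C y) (ket x) = ket x"
  shows "ev N (concat (map C ys)) (ket x) = ket x"
  using assms by (induction ys) (auto simp: ev_append)

text \<open>The signs are opposite to those of \<open>run_givens_mux\<close>, which pulls an
  amplitude from the swapped string instead of pushing a ket there: a one moving from
  \<open>q\<close> to \<open>p\<close> gets plus the sine.\<close>

lemma ev_givens_mux:
  assumes "distinct (p # q # cs)" "set (p # q # cs) \<subseteq> {..<length x}"
  shows "ev (length x) (givens_mux p q cs \<theta>) (ket x) = (if x ! p = x ! q then ket x else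
     (\<lambda>b. complex_of_real (cos (\<theta> (restrict_bits x cs))) * ket x b +
       (if x ! p then - 1 else 1) * complex_of_real (sin (\<theta> (restrict_bits x cs))) * ket (swap_bits p q x) b))"
    (is "?l = ?r")
proof
  fix b
  have pq: "p < length x" "q < length x" "p \<notin> set cs" "q \<notin> set cs" "p \<noteq> q" using assms by auto
  show "?l b = ?r b"
  proof (cases "length b = length x")
    case True
    have "run (givens_mux p q cs \<theta>) (ket x) b = ?r b"
    proof -
      have b: "run (givens_mux p q cs \<theta>) (ket x) b = (if b ! p = b ! q then ket x b else
         complex_of_real (cos (\<theta> (restrict_bits b cs))) * ket x b +
         (if b ! p then 1 else - 1) * complex_of_real (sin (\<theta> (restrict_bits b cs))) * ket x (swap_bits p q b))"
        by (rule run_givens_mux) (use assms True in auto)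
      have ne: "swap_bits p q x \<noteq> x" if "x ! p \<noteq> x ! q"
        using that pq by (metis nth_swap_bits)
      consider "b = x" | "b = swap_bits p q x" "b \<noteq> x" | "b \<noteq> x" "b \<noteq> swap_bits p q x" by blast
      then show ?thesis
      proof cases
        case 1
        then show ?thesis using b ne by (auto simp: ket_def)
      next
        case 2
        have neq: "x ! p \<noteq> x ! q"
        proof
          assume "x ! p = x ! q"
          then have "swap_bits p q x = x"
            using pq by (intro nth_equalityI) (simp_all add: nth_swap_bits)
          then show False using 2 by simp
        qed
        have "run (givens_mux p q cs \<theta>) (ket x) b
            = (if x ! p then - 1 else 1) * complex_of_real (sin (\<theta> (restrict_bits x cs)))"
          using neq pq 2(2) unfolding b by (simp add: 2(1) nth_swap_bits ket_def)
        then show ?thesis using neq 2 by (simp add: ket_def)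
      next
        case 3
        have "swap_bits p q b \<noteq> x"
        proof
          assume "swap_bits p q b = x"
          then have "swap_bits p q x = swap_bits p q (swap_bits p q b)" by simp
          then show False using 3 pq True by simp
        qed
        then show ?thesis using b 3 by (auto simp: ket_def)
      qed
    qed
    then show ?thesis using True by (simp add: ev_def)
  next
    case False
    then have "b \<noteq> x" "b \<noteq> swap_bits p q x" by auto
    then show ?thesis using False by (auto simp: ev_def ket_def)
  qed
qed

lemma polar:
  fixes x y r :: real
  assumes "r\<^sup>2 = x\<^sup>2 + y\<^sup>2" "0 \<le> r"
  shows "\<exists>t. r * cos t = x \<and> r * sin t = y"
proof (cases "r = 0")
  case True
  then show ?thesis using assms(1) by (simp add: sum_power2_eq_zero_iff)
next
  case False
  have "(x / r)\<^sup>2 + (y / r)\<^sup>2 = 1"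
    using False unfolding power_divide add_divide_distrib[symmetric] assms(1)[symmetric] by simp
  then obtain t where "x / r = cos t" "y / r = sin t"
    using sincos_total_2pi by blast
  then show ?thesis using False by (intro exI[of _ t]) (simp add: field_simps)
qed

text \<open>Scaling by \<open>r\<close> keeps the specification satisfiable for
  \<open>r = 0\<close>, where x = y = 0 and any angle does. For the same reason the correctness
  lemmas below multiply an output by a norm instead of dividing by it.\<close>

definition angle :: "real \<Rightarrow> real \<Rightarrow> real \<Rightarrow> real" where
  "angle r x y = (SOME t. r * cos t = x \<and> r * sin t = y)"

lemma angle:
  assumes "r\<^sup>2 = x\<^sup>2 + y\<^sup>2" "0 \<le> r"
  shows "r * cos (angle r x y) = x" "r * sin (angle r x y) = y"
  using someI_ex[OF polar[OF assms]] unfolding angle_def by auto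


section \<open>Leaf encoders\<close>

lemma hw_simps [simp]: "hw [] = 0" "hw (x # b) = (if x then 1 else 0) + hw b" "hw (a @ b) = hw a + hw b"
  by (simp_all add: hw_def)

lemma hw_le_length: "hw b \<le> length b"
  by (induction b) auto

lemma length_unary [simp]: "i \<le> m \<Longrightarrow> length (unary m i) = m"
  by (simp add: unary_def)

lemma nth_unary: "\<lbrakk>r \<le> m; i < m\<rbrakk> \<Longrightarrow> unary m r ! i \<longleftrightarrow> m - r \<le> i"
  by (auto simp: unary_def nth_append)

lemma nth_append_unary:
  "\<lbrakk>r \<le> m - p; p \<le> m; length x = p; i < m\<rbrakk> \<Longrightarrow>
    (x @ unary (m - p) r) ! i = (if i < p then x ! i else m - r \<le> i)"
  by (auto simp: nth_append nth_unary)

lemma unary_split_False: "r \<le> m \<Longrightarrow> unary (Suc m) r = False # unary m r"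
  by (simp add: unary_def Suc_diff_le)

lemma unary_full: "unary (Suc m) (Suc m) = True # unary m m"
  by (simp add: unary_def)

text \<open>The extra control \<open>q - 1\<close> is dropped when it is the rotated position
  \<open>p\<close> itself. If present, it has index \<open>p\<close> in the control string, which is
  how \<open>leaf_block\<close> finds it.\<close>

definition leaf_controls :: "nat \<Rightarrow> nat \<Rightarrow> nat list" where
  "leaf_controls p q = [0..<p] @ (if q = Suc p then [] else [q - 1])"

text \<open>
  The control just left of position \<open>m - r\<close> makes the block act only where that position holds the leading one of
  the unary remainder.
\<close>

definition leaf_block :: "nat \<Rightarrow> (nat \<Rightarrow> bits \<Rightarrow> real) \<Rightarrow> nat \<Rightarrow> nat \<Rightarrow> circuit" where
  "leaf_block m \<theta> p r = givens_mux p (m - r) (leaf_controls p (m - r))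
     (\<lambda>x. if p < length x \<and> x ! p then 0 else \<theta> r (take p x))"

text \<open>The remainder \<open>r\<close> must decrease. A branch whose leading one has moved to
  \<open>p\<close> has ones at \<open>p\<close> and at m - r' for all later r' < r, so it is left
  alone; in increasing order it would meet some r' > r with a zero at m - r' and could be rotated
  again. The values 0 and m - p are absent because they force bit \<open>p\<close>.\<close>

definition leaf_stage :: "nat \<Rightarrow> (nat \<Rightarrow> bits \<Rightarrow> real) \<Rightarrow> nat \<Rightarrow> circuit" where
  "leaf_stage m \<theta> p = concat (map (leaf_block m \<theta> p) (rev [1..<m - p]))"

lemma leaf_controls_ok:
  assumes "p < q" "q < m"
  shows "distinct (p # q # leaf_controls p q)" "set (p # q # leaf_controls p q) \<subseteq> {..<m}"
  using assms by (auto simp: leaf_controls_def)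

lemma ev_leaf_block_fixed:
  assumes "length b = m" "1 \<le> r" "r < m - p"
    and "b ! p = b ! (m - r) \<or> (m - r \<noteq> Suc p \<and> b ! (m - r - 1))"
  shows "ev m (leaf_block m \<theta> p r) (ket b) = ket b"
proof -
  have q: "p < m - r" "m - r < m" using assms by auto
  note ok = leaf_controls_ok[OF q]
  have "restrict_bits b (leaf_controls p (m - r)) ! p = b ! (m - r - 1)"
    if "m - r \<noteq> Suc p" using that by (simp add: leaf_controls_def restrict_bits_def nth_append)
  moreover have "length (leaf_controls p (m - r)) = Suc p" if "m - r \<noteq> Suc p"
    using that by (simp add: leaf_controls_def)
  ultimately show ?thesis
    unfolding leaf_block_def using ev_givens_mux[of p "m - r" "leaf_controls p (m - r)" b] ok assms by auto
qed

lemma ev_leaf_block_split: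
  assumes x: "length x = p" and r: "1 \<le> r" "r < m - p"
  shows "ev m (leaf_block m \<theta> p r) (ket (x @ unary (m - p) r)) = (\<lambda>b.
     complex_of_real (cos (\<theta> r x)) * ket (x @ False # unary (m - Suc p) r) b +
     complex_of_real (sin (\<theta> r x)) * ket (x @ True # unary (m - Suc p) (r - 1)) b)"
proof -
  let ?b = "x @ unary (m - p) r"
  have q: "p < m - r" "m - r < m" and len: "length ?b = m" using assms by auto
  note ok = leaf_controls_ok[OF q]
  have nth: "?b ! i = (if i < p then x ! i else m - r \<le> i)" if "i < m" for i
    using nth_append_unary[of r m p x i] assms that by auto
  have b: "\<not> ?b ! p" "?b ! (m - r)" "m - r \<noteq> Suc p \<Longrightarrow> \<not> ?b ! (m - r - 1)"
    using q r nth[of p] nth[of "m - r"] nth[of "m - r - 1"] by auto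
  have swap: "swap_bits p (m - r) ?b = x @ True # unary (m - Suc p) (r - 1)"
  proof (rule nth_equalityI)
    show "length (swap_bits p (m - r) ?b) = length (x @ True # unary (m - Suc p) (r - 1))"
      using len assms by simp
    fix i assume "i < length (swap_bits p (m - r) ?b)"
    then have i: "i < m" using len by simp
    have "((x @ [True]) @ unary (m - Suc p) (r - 1)) ! i = (if i < Suc p then (x @ [True]) ! i else m - (r - 1) \<le> i)"
      by (rule nth_append_unary) (use assms i in auto)
    then show "swap_bits p (m - r) ?b ! i = (x @ True # unary (m - Suc p) (r - 1)) ! i"
      using nth_swap_bits[of p ?b "m - r" i] q len b nth[OF i] i assms
      by (auto simp: nth_append less_Suc_eq)
  qed
  have res: "restrict_bits ?b (leaf_controls p (m - r)) = x @ (if m - r = Suc p then [] else [False])"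
  proof -
    have "map ((!) ?b) [0..<p] = x" using x by (intro nth_equalityI) (auto simp: nth_append)
    then show ?thesis using b(3) by (auto simp: restrict_bits_def leaf_controls_def)
  qed
  have False_eq: "?b = x @ False # unary (m - Suc p) r"
    using unary_split_False[of r "m - Suc p"] assms by (simp add: Suc_diff_Suc)
  have "ev (length ?b) (leaf_block m \<theta> p r) (ket ?b) = (\<lambda>b.
     complex_of_real (cos (\<theta> r x)) * ket ?b b +
     complex_of_real (sin (\<theta> r x)) * ket (x @ True # unary (m - Suc p) (r - 1)) b)"
    unfolding leaf_block_def using ok len b(1,2) x
    by (subst ev_givens_mux) (auto simp: swap res)
  then show ?thesis unfolding len by (simp add: False_eq)
qed

lemma ev_leaf_stage_trivial:
  assumes x: "length x = p" and p: "p < m" and r: "r = 0 \<or> r = m - p"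
  shows "ev m (leaf_stage m \<theta> p) (ket (x @ unary (m - p) r)) = ket (x @ unary (m - p) r)"
  unfolding leaf_stage_def
proof (rule ev_fixed)
  fix r' assume "r' \<in> set (rev [1..<m - p])"
  then have r': "1 \<le> r'" "r' < m - p" by auto
  have "(x @ unary (m - p) r) ! p = (x @ unary (m - p) r) ! (m - r')"
      by (subst (1 2) nth_append_unary) (use assms r' in auto)
    then show "ev m (leaf_block m \<theta> p r') (ket (x @ unary (m - p) r)) = ket (x @ unary (m - p) r)"
      by (intro ev_leaf_block_fixed disjI1) (use assms r' in auto)
qed (use assms in auto)

lemma ev_leaf_stage:
  assumes x: "length x = p" and r: "1 \<le> r" "r < m - p"
  shows "ev m (leaf_stage m \<theta> p) (ket (x @ unary (m - p) r)) = (\<lambda>b.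
     complex_of_real (cos (\<theta> r x)) * ket (x @ False # unary (m - Suc p) r) b +
     complex_of_real (sin (\<theta> r x)) * ket (x @ True # unary (m - Suc p) (r - 1)) b)"
proof -
  let ?B = "leaf_block m \<theta> p"
  let ?b = "x @ unary (m - p) r" and ?c = "x @ True # unary (m - Suc p) (r - 1)"
  have "[1..<m - p] = [1..<r] @ [r] @ [Suc r..<m - p]"
    using r by (metis append_Cons append_Nil less_imp_le_nat upt_add_eq_append upt_conv_Cons le_add_diff_inverse)
  then have split: "leaf_stage m \<theta> p
      = concat (map ?B (rev [Suc r..<m - p])) @ ?B r @ concat (map ?B (rev [1..<r]))"
    by (simp add: leaf_stage_def)
  have nb: "?b ! i = (if i < p then x ! i else m - r \<le> i)" if "i < m" for i
    using nth_append_unary[of r m p x i] assms that by auto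
  have nc: "?c ! i = (if i < p then x ! i else i = p \<or> m - (r - 1) \<le> i)" if "i < m" for i
    using nth_append_unary[of "r - 1" m "Suc p" "x @ [True]" i] assms that
    by (auto simp: nth_append less_Suc_eq)
  have before: "ev m (concat (map ?B (rev [Suc r..<m - p]))) (ket ?b) = ket ?b"
  proof (rule ev_fixed)
    fix r' assume "r' \<in> set (rev [Suc r..<m - p])"
    then have r': "r < r'" "r' < m - p" by auto
    have "?b ! p = ?b ! (m - r')"
      by (subst (1 2) nb) (use assms r' in auto)
    then show "ev m (?B r') (ket ?b) = ket ?b"
      by (intro ev_leaf_block_fixed disjI1) (use assms r' in auto)
  qed (use assms in auto)
  \<comment> \<open>In the branch that kept its leading one, the position left of m - r' is a one as
    well, so the control selects the zero angle.\<close>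
  have after_b: "ev m (concat (map ?B (rev [1..<r]))) (ket ?b) = ket ?b"
  proof (rule ev_fixed)
    fix r' assume "r' \<in> set (rev [1..<r])"
    then have r': "1 \<le> r'" "r' < r" by auto
    have "?b ! (m - r' - 1)" by (subst nb) (use assms r' in auto)
    then show "ev m (?B r') (ket ?b) = ket ?b"
      by (intro ev_leaf_block_fixed disjI2) (use assms r' in auto)
  qed (use assms in auto)
  have after_c: "ev m (concat (map ?B (rev [1..<r]))) (ket ?c) = ket ?c"
  proof (rule ev_fixed)
    fix r' assume "r' \<in> set (rev [1..<r])"
    then have r': "1 \<le> r'" "r' < r" by auto
    have "?c ! p = ?c ! (m - r')"
      by (subst (1 2) nc) (use assms r' in auto)
    then show "ev m (?B r') (ket ?c) = ket ?c"
      by (intro ev_leaf_block_fixed disjI1) (use assms r' in auto)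
  qed (use assms in auto)
  have b_eq: "x @ False # unary (m - Suc p) r = ?b"
    using unary_split_False[of r "m - Suc p"] assms by (simp add: Suc_diff_Suc)
  show ?thesis
    unfolding split by (simp add: ev_append before ev_leaf_block_split[OF assms] ev_add after_c)
      (simp add: b_eq after_b[unfolded One_nat_def] after_c[unfolded One_nat_def])
qed

definition leaf_tree :: "nat \<Rightarrow> (nat \<Rightarrow> nat \<Rightarrow> bits \<Rightarrow> real) \<Rightarrow> nat \<Rightarrow> circuit" where
  "leaf_tree m \<theta> p = concat (map (\<lambda>p. leaf_stage m (\<theta> p) p) [p..<m])"

text \<open>\<open>A i x\<close> stands for the norm of the weight-\<open>i\<close> target on
  strings with prefix \<open>x\<close>. On the way to \<open>y\<close> the cosines and sines
  telescope to the quotient of \<open>A i y\<close> by \<open>A i x\<close>. The index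
  \<open>hw x + r\<close> recovers the target weight from the current string, so the same angles
  serve all inputs.\<close>

lemma ev_leaf_tree:
  fixes A :: "nat \<Rightarrow> bits \<Rightarrow> real"
  assumes nonneg: "\<And>i x. 0 \<le> A i x"
    and split: "\<And>i x. length x < m \<Longrightarrow> (A i x)\<^sup>2 = (A i (x @ [False]))\<^sup>2 + (A i (x @ [True]))\<^sup>2"
    and low: "\<And>i x. i < hw x \<Longrightarrow> A i x = 0"
    and high: "\<And>i x. hw x + (m - length x) < i \<Longrightarrow> A i x = 0"
    and \<theta>: "\<And>p r x. \<theta> p r x = angle (A (hw x + r) x) (A (hw x + r) (x @ [False])) (A (hw x + r) (x @ [True]))"
    and "p \<le> m" "length x = p" "r \<le> m - p" "length y = m"
  shows "A (hw x + r) x * ev m (leaf_tree m \<theta> p) (ket (x @ unary (m - p) r)) y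
    = (if take p y = x \<and> hw y = hw x + r then A (hw x + r) y else 0)"
  using assms(6-8)
proof (induction "m - p" arbitrary: p x r)
  case 0
  then have p: "p = m" "r = 0" by auto
  have "take m y = y" using assms by simp
  then show ?case using p 0 by (simp add: leaf_tree_def unary_def) (auto simp: ket_def)
next
  case (Suc d)
  then have p: "p < m" "length x < m" by auto
  let ?i = "hw x + r"
  let ?x0 = "x @ [False]" and ?x1 = "x @ [True]"
  have tree: "leaf_tree m \<theta> p = leaf_stage m (\<theta> p) p @ leaf_tree m \<theta> (Suc p)"
    using p by (simp add: leaf_tree_def upt_conv_Cons)
  have take: "take p y = x \<longleftrightarrow> take (Suc p) y = ?x0 \<or> take (Suc p) y = ?x1"
    using p assms(9) Suc.prems by (auto simp: take_Suc_conv_app_nth)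
  have IH0: "A ?i ?x0 * ev m (leaf_tree m \<theta> (Suc p)) (ket (?x0 @ unary (m - Suc p) r)) y
      = (if take (Suc p) y = ?x0 \<and> hw y = ?i then A ?i y else 0)" if "r \<le> m - Suc p"
    using Suc.hyps(1)[of "Suc p" ?x0 r] Suc.hyps(2) Suc.prems p that by simp
  have IH1: "A ?i ?x1 * ev m (leaf_tree m \<theta> (Suc p)) (ket (?x1 @ unary (m - Suc p) (r - 1))) y
      = (if take (Suc p) y = ?x1 \<and> hw y = ?i then A ?i y else 0)" if "1 \<le> r"
    using Suc.hyps(1)[of "Suc p" ?x1 "r - 1"] Suc.hyps(2) Suc.prems p that by simp
  have sq: "(A ?i x)\<^sup>2 = (A ?i ?x0)\<^sup>2 + (A ?i ?x1)\<^sup>2" using split p by blast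
  consider "r = 0" | "r = m - p" "1 \<le> r" | "1 \<le> r" "r < m - p" using Suc.prems by linarith
  then show ?case
  proof cases
    \<comment> \<open>No ones are left: bit \<open>p\<close> must be zero, and the stage acts
      trivially.\<close>
    case 1
    then have A1: "A ?i ?x1 = 0" by (intro low) simp
    then have A0: "A ?i ?x0 = A ?i x" using sq nonneg by (simp add: power2_eq_iff_nonneg)
    have "x @ unary (m - p) r = ?x0 @ unary (m - Suc p) r"
      using 1 p unary_split_False[of 0 "m - Suc p"] by (simp add: Suc_diff_Suc)
    moreover have "\<not> (take (Suc p) y = ?x1 \<and> hw y = ?i)"
    proof
      assume *: "take (Suc p) y = ?x1 \<and> hw y = ?i"
      have "hw y = hw (take (Suc p) y) + hw (drop (Suc p) y)" by (metis append_take_drop_id hw_simps(3))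
      then show False using * 1 by simp
    qed
    ultimately show ?thesis using 1 IH0 A0 ev_leaf_stage_trivial[of x p m r "\<theta> p"] Suc.prems p take
      by (auto simp: tree ev_append)
  next
    \<comment> \<open>All remaining positions are ones: bit \<open>p\<close> must be one, and the
      input already has it.\<close>
    case 2
    then have A0: "A ?i ?x0 = 0" using Suc.prems p by (intro high) simp
    then have A1: "A ?i ?x1 = A ?i x" using sq nonneg by (simp add: power2_eq_iff_nonneg)
    have "x @ unary (m - p) r = ?x1 @ unary (m - Suc p) (r - 1)"
      using 2 p unary_full[of "m - Suc p"] by (simp add: Suc_diff_Suc)
    moreover have "\<not> (take (Suc p) y = ?x0 \<and> hw y = ?i)"
    proof
      assume *: "take (Suc p) y = ?x0 \<and> hw y = ?i"
      have "hw y = hw (take (Suc p) y) + hw (drop (Suc p) y)" by (metis append_take_drop_id hw_simps(3))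
      moreover have "hw (drop (Suc p) y) \<le> m - Suc p"
        using hw_le_length[of "drop (Suc p) y"] assms(9) by simp
      ultimately show False using * 2 p by simp
    qed
    ultimately show ?thesis using 2 IH1 A1 ev_leaf_stage_trivial[of x p m r "\<theta> p"] Suc.prems p take
      by (auto simp: tree ev_append)
  next
    case 3
    have t: "A ?i x * cos (\<theta> p r x) = A ?i ?x0" "A ?i x * sin (\<theta> p r x) = A ?i ?x1"
      unfolding \<theta> using angle[OF sq] nonneg by auto
    have "A ?i x * ev m (leaf_tree m \<theta> p) (ket (x @ unary (m - p) r)) y
       = complex_of_real (A ?i x * cos (\<theta> p r x)) * ev m (leaf_tree m \<theta> (Suc p)) (ket (?x0 @ unary (m - Suc p) r)) y
       + complex_of_real (A ?i x * sin (\<theta> p r x)) * ev m (leaf_tree m \<theta> (Suc p)) (ket (?x1 @ unary (m - Suc p) (r - 1))) y"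
      using ev_leaf_stage[of x p r m "\<theta> p"] 3 Suc.prems by (simp add: tree ev_append ev_add algebra_simps)
    also have "\<dots> = (if take (Suc p) y = ?x0 \<and> hw y = ?i then A ?i y else 0)
        + (if take (Suc p) y = ?x1 \<and> hw y = ?i then A ?i y else 0)"
      unfolding t using IH0 IH1 3 by simp
    also have "\<dots> = (if take p y = x \<and> hw y = ?i then A ?i y else 0)"
      using take by auto
    finally show ?thesis .
  qed
qed

section \<open>Norms of the target vectors over prefixes, and the full leaf encoder\<close>

definition prefix_norm :: "nat \<Rightarrow> (nat \<Rightarrow> state) \<Rightarrow> nat \<Rightarrow> bits \<Rightarrow> real" where
  "prefix_norm m \<eta> i x =
     sqrt (\<Sum>g\<in>{g \<in> bitstrings m. take (length x) g = x \<and> hw g = i}. (cmod (\<eta> i g))\<^sup>2)"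

lemma prefix_norm_nonneg: "0 \<le> prefix_norm m \<eta> i x"
  by (simp add: prefix_norm_def sum_nonneg)

lemma prefix_norm_split:
  assumes "length x < m"
  shows "(prefix_norm m \<eta> i x)\<^sup>2 = (prefix_norm m \<eta> i (x @ [False]))\<^sup>2 + (prefix_norm m \<eta> i (x @ [True]))\<^sup>2"
proof -
  let ?S = "\<lambda>x. {g \<in> bitstrings m. take (length x) g = x \<and> hw g = i}"
  have "take (length x) g = x \<longleftrightarrow> take (Suc (length x)) g = x @ [False] \<or> take (Suc (length x)) g = x @ [True]"
    if "length g = m" for g :: bits
    using that assms by (auto simp: take_Suc_conv_app_nth)
  then have S: "?S x = ?S (x @ [False]) \<union> ?S (x @ [True])" by auto
  have fin: "finite (?S y)" for y
    by (rule finite_subset[OF _ finite_bitstrings[of m]]) auto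
  have "(\<Sum>g\<in>?S x. (cmod (\<eta> i g))\<^sup>2)
      = (\<Sum>g\<in>?S (x @ [False]). (cmod (\<eta> i g))\<^sup>2) + (\<Sum>g\<in>?S (x @ [True]). (cmod (\<eta> i g))\<^sup>2)"
    unfolding S by (rule sum.union_disjoint[OF fin fin]) auto
  then show ?thesis by (simp add: prefix_norm_def sum_nonneg)
qed

lemma hw_take_drop: "hw y = hw (take p y) + hw (drop p y)"
  by (metis append_take_drop_id hw_simps(3))

lemma prefix_norm_low:
  assumes "i < hw x"
  shows "prefix_norm m \<eta> i x = 0"
proof -
  have "hw g \<noteq> i" if "take (length x) g = x" for g
    using assms that hw_take_drop[of g "length x"] by simp
  then have "{g \<in> bitstrings m. take (length x) g = x \<and> hw g = i} = {}" by auto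
  then show ?thesis unfolding prefix_norm_def by (simp only: sum.empty real_sqrt_zero)
qed

lemma prefix_norm_high:
  assumes "hw x + (m - length x) < i"
  shows "prefix_norm m \<eta> i x = 0"
proof -
  have "hw g \<noteq> i" if "take (length x) g = x" "length g = m" for g
    using assms that hw_take_drop[of g "length x"] hw_le_length[of "drop (length x) g"] by simp
  then have "{g \<in> bitstrings m. take (length x) g = x \<and> hw g = i} = {}" by auto
  then show ?thesis unfolding prefix_norm_def by (simp only: sum.empty real_sqrt_zero)
qed

text \<open>The weight is visible in the output \<open>y\<close>, so one diagonal circuit supplies
  the phases of all vectors \<open>\<eta> i\<close>.\<close>

definition leaf_circuit :: "nat \<Rightarrow> (nat \<Rightarrow> state) \<Rightarrow> circuit" where
  "leaf_circuit m \<eta> =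
     leaf_tree m (\<lambda>p r x. let A = prefix_norm m \<eta> (hw x + r)
                         in angle (A x) (A (x @ [False])) (A (x @ [True]))) 0 @
     diag_circuit [0..<m] (\<lambda>y. Arg (\<eta> (hw y) y))"

lemma run_leaf_circuit:
  assumes "i \<le> m" "length y = m"
    and norm: "(\<Sum>g\<in>{g \<in> bitstrings m. hw g = i}. (cmod (\<eta> i g))\<^sup>2) = 1"
  shows "run (leaf_circuit m \<eta>) (ket (unary m i)) y = (if hw y = i then \<eta> i y else 0)"
proof -
  let ?A = "prefix_norm m \<eta>"
  let ?T = "leaf_tree m (\<lambda>p r x. let A = ?A (hw x + r)
                         in angle (A x) (A (x @ [False])) (A (x @ [True]))) 0"
  have A1: "?A i [] = 1" using norm by (simp add: prefix_norm_def)
  have "{g \<in> bitstrings m. take (length y) g = y \<and> hw g = hw y} = {y}" using assms(2) by auto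
  then have Ay: "?A (hw y) y = cmod (\<eta> (hw y) y)" by (simp add: prefix_norm_def)
  have "?A (hw [] + i) [] * ev m ?T (ket ([] @ unary (m - 0) i)) y
      = (if take 0 y = [] \<and> hw y = hw [] + i then ?A (hw [] + i) y else 0)"
    by (rule ev_leaf_tree)
      (use assms in \<open>auto simp: prefix_norm_nonneg prefix_norm_split prefix_norm_low prefix_norm_high Let_def\<close>)
  then have T: "run ?T (ket (unary m i)) y = (if hw y = i then complex_of_real (?A i y) else 0)"
    using A1 assms(2) by (simp add: ev_def)
  have y: "restrict_bits y [0..<m] = y"
    using assms(2) by (auto simp: restrict_bits_def intro: nth_equalityI)
  have "run (leaf_circuit m \<eta>) (ket (unary m i)) y = cis (Arg (\<eta> (hw y) y)) * run ?T (ket (unary m i)) y"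
    unfolding leaf_circuit_def run_append by (subst run_diag_circuit) (use assms(2) y in auto)
  also have "\<dots> = (if hw y = i then \<eta> i y else 0)"
    using T Ay rcis_cmod_Arg[of "\<eta> (hw y) y"] by (auto simp: rcis_def mult.commute)
  finally show ?thesis .
qed

lemma valid_circuit_concat:
  "valid_circuit N (concat (map C xs)) \<longleftrightarrow> (\<forall>x\<in>set xs. valid_circuit N (C x))"
  by (auto simp: valid_circuit_def)

lemma valid_leaf_circuit:
  assumes "0 < m"
  shows "valid_circuit m (leaf_circuit m \<eta>)"
proof -
  have "valid_circuit m (leaf_block m \<theta> p r)" if "r \<in> set (rev [1..<m - p])" for \<theta> p r
  proof -
    have "p < m - r" "m - r < m" using that by auto
    then show ?thesis unfolding leaf_block_def by (intro valid_givens_mux leaf_controls_ok)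
  qed
  then show ?thesis
    using assms unfolding leaf_circuit_def leaf_tree_def leaf_stage_def
    by (simp only: valid_circuit_append valid_circuit_concat) (auto intro: valid_diag_circuit)
qed

text \<open>Later stages have more controls but fewer rotations, and this sum shows that the total
  carries no extra factor m. Passing from m to m + 1 adds 2^p to the p-th summand.\<close>

lemma weighted_geometric_sum: "(\<Sum>p<m. (m - Suc p) * 2 ^ p) + m + 1 = 2 ^ m"
proof (induction m)
  case (Suc m)
  have "(\<Sum>p<m. (m - p) * 2 ^ p) = (\<Sum>p<m. (m - Suc p) * 2 ^ p + 2 ^ p)"
  proof (rule sum.cong)
    fix p assume "p \<in> {..<m}"
    then have "m - p = Suc (m - Suc p)" by auto
    then show "(m - p) * 2 ^ p = (m - Suc p) * 2 ^ p + 2 ^ p" by simp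
  qed simp
  also have "\<dots> = (\<Sum>p<m. (m - Suc p) * 2 ^ p) + (2 ^ m - 1)"
    by (simp add: sum.distrib mask_eq_sum_exp_nat[symmetric] lessThan_def)
  finally show ?case using Suc by simp
qed simp

lemma length_concat_le:
  assumes "\<And>x. x \<in> set xs \<Longrightarrow> length (C x) \<le> d"
  shows "length (concat (map C xs)) \<le> length xs * d"
  using assms
proof (induction xs)
  case (Cons x xs)
  have "length (C x) \<le> d" "length (concat (map C xs)) \<le> length xs * d"
    using Cons by auto
  then show ?case by simp
qed simp

lemma length_leaf_circuit: "length (leaf_circuit m \<eta>) \<le> 9 * 2 ^ m"
proof -
  \<comment> \<open>At most p + 1 controls, and 3 * 2^(p + 1) = 6 * 2^p.\<close>
  have block: "length (leaf_block m \<theta> p r) \<le> 6 * 2 ^ p" for \<theta> p r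
  proof -
    have "length (leaf_controls p (m - r)) \<le> Suc p" by (simp add: leaf_controls_def)
    then have "3 * 2 ^ length (leaf_controls p (m - r)) \<le> (3 * 2 ^ Suc p :: nat)"
      by (intro mult_le_mono2 power_increasing) auto
    then show ?thesis 
      unfolding leaf_block_def by (intro order_trans[OF length_givens_mux]) simp
  qed
  have stage: "length (leaf_stage m \<theta> p) \<le> (m - Suc p) * (6 * 2 ^ p)" for \<theta> p
    unfolding leaf_stage_def
    using length_concat_le[of "rev [1..<m - p]" "leaf_block m \<theta> p" "6 * 2 ^ p"] block by simp
  have "length (leaf_tree m \<theta> 0) \<le> (\<Sum>p<m. (m - Suc p) * (6 * 2 ^ p))" for \<theta>
  proof -
    have "length (leaf_tree m \<theta> 0) = (\<Sum>p<m. length (leaf_stage m (\<theta> p) p))"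
      by (simp add: leaf_tree_def length_concat comp_def interv_sum_list_conv_sum_set_nat lessThan_atLeast0)
    then show ?thesis using stage by (simp add: sum_mono)
  qed
  also have "(\<Sum>p<m. (m - Suc p) * (6 * 2 ^ p)) = 6 * (\<Sum>p<m. (m - Suc p) * 2 ^ p)"
    by (simp add: sum_distrib_left mult_ac)
  also have "\<dots> \<le> 6 * 2 ^ m" using weighted_geometric_sum[of m] by simp
  finally have tree: "length (leaf_tree m \<theta> 0) \<le> 6 * 2 ^ m" for \<theta> .
  have diag: "length (diag_circuit [0..<m] \<phi>) \<le> 3 * 2 ^ m" for \<phi>
    using length_diag_circuit[of "[0..<m]" \<phi>] by simp
  show ?thesis unfolding leaf_circuit_def length_append
    by (rule order_trans[OF add_mono[OF tree diag]]) simp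
qed


section \<open>Generalized weight distribution blocks\<close>

text \<open>Neighbours are taken within the register of each child. Where one is missing, the end of
  the register confines the boundary of the unary string instead.\<close>

definition window :: "nat \<Rightarrow> nat \<Rightarrow> nat \<Rightarrow> nat \<Rightarrow> nat list" where
  "window m N p q = (if 0 < p then [p - 1] else []) @ (if Suc p < m then [Suc p] else []) @
     (if m < q then [q - 1] else []) @ (if Suc q < N then [Suc q] else [])"

lemma window_ok:
  assumes "p < m" "m \<le> q" "q < N"
  shows "distinct (p # q # window m N p q)" "set (p # q # window m N p q) \<subseteq> {..<N}"
  using assms by (auto simp: window_def)

lemma length_window: "length (window m N p q) \<le> 4"
  by (simp add: window_def)

lemma nth_two_unary:
  "\<lbrakk>a \<le> m; b \<le> m'; i < m + m'\<rbrakk> \<Longrightarrow>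
    (unary m a @ unary m' b) ! i = (if i < m then m - a \<le> i else m + m' - b \<le> i)"
  by (auto simp: nth_append nth_unary)

text \<open>
  Seen through its window, the pair of positions changed by the block \<open>(a, b)\<close> determines the two
  unary states \<open>(a, b)\<close> and \<open>(a + 1, b - 1)\<close> that the block mixes.
\<close>

definition wdb_block :: "nat \<Rightarrow> nat \<Rightarrow> (nat \<times> nat \<Rightarrow> real) \<Rightarrow> nat \<times> nat \<Rightarrow> circuit" where
  "wdb_block m m' \<theta> = (\<lambda>(a, b). let p = m - Suc a; q = m + m' - b; cs = window m (m + m') p q in
     givens_mux p q cs (\<lambda>x. if x = restrict_bits (unary m a @ unary m' b) cs then \<theta> (a, b) else 0))"

definition wdb_qubits :: "nat \<Rightarrow> nat \<Rightarrow> nat \<times> nat \<Rightarrow> nat set" where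
  "wdb_qubits m m' = (\<lambda>(a, b). let p = m - Suc a; q = m + m' - b in set (p # q # window m (m + m') p q))"

text \<open>By monotonicity, a matching window pins the left boundary to p or p + 1 and the right
  one to q or q + 1. If moreover the bits at p and q differ, only the two excluded states are left;
  if they agree, the rotation is trivial.\<close>

lemma ev_wdb_block_fixed:
  assumes ab: "a < m" "1 \<le> b" "b \<le> m'" and ab': "a' \<le> m" "b' \<le> m'"
    and ne: "(a', b') \<noteq> (a, b)" "(a', b') \<noteq> (Suc a, b - 1)"
  shows "ev (m + m') (wdb_block m m' \<theta> (a, b)) (ket (unary m a' @ unary m' b')) = ket (unary m a' @ unary m' b')"
proof -
  let ?x = "unary m a' @ unary m' b'" and ?y = "unary m a @ unary m' b"
  define p q where "p = m - Suc a" and "q = m + m' - b"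
  let ?cs = "window m (m + m') p q"
  have pq: "p < m" "m \<le> q" "q < m + m'" using ab by (auto simp: p_def q_def)
  have a: "a = m - Suc p" and b: "b = m + m' - q" using ab by (auto simp: p_def q_def)
  have len: "length ?x = m + m'" using ab' by simp
  have x: "?x ! i = (if i < m then m - a' \<le> i else m + m' - b' \<le> i)" if "i < m + m'" for i
    using nth_two_unary ab' that by auto
  have y: "?y ! i = (if i < m then p < i else q \<le> i)" if "i < m + m'" for i
    using nth_two_unary[of a m b m' i] ab that by (auto simp: p_def q_def)
  have "restrict_bits ?x ?cs \<noteq> restrict_bits ?y ?cs" if "?x ! p \<noteq> ?x ! q"
  proof
    assume eq: "restrict_bits ?x ?cs = restrict_bits ?y ?cs"
    have *: "?x ! i = ?y ! i" if "i \<in> set ?cs" for i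
      using eq that by (auto simp: restrict_bits_def)
    have xy: "(if i < m then m - a' \<le> i else m + m' - b' \<le> i) \<longleftrightarrow> (if i < m then p < i else q \<le> i)"
      if "i \<in> set ?cs" for i
    proof -
      have "i < m + m'" using that window_ok[OF pq] by auto
      then show ?thesis using *[OF that] by (simp only: x y)
    qed
    have 1: "\<not> m - a' \<le> p - 1" if "0 < p"
      using xy[of "p - 1"] that pq by (auto simp: window_def split: if_splits)
    have 2: "m - a' \<le> Suc p" if "Suc p < m"
      using xy[of "Suc p"] that pq by (auto simp: window_def split: if_splits)
    have 3: "\<not> m + m' - b' \<le> q - 1" if "m < q"
      using xy[of "q - 1"] that pq by (auto simp: window_def split: if_splits)
    have 4: "m + m' - b' \<le> Suc q" if "Suc q < m + m'"
      using xy[of "Suc q"] that pq by (auto simp: window_def split: if_splits)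
    have "(m - a' \<le> p) \<noteq> (m + m' - b' \<le> q)"
      using that x[of p] x[of q] pq by auto
    moreover have "a' = Suc a \<and> b' = b - 1" if "m - a' \<le> p" "\<not> m + m' - b' \<le> q"
    proof -
      have "m - a' = p" using that(1) 1 by (cases "p = 0") linarith+
      moreover have "m + m' - b' = Suc q" using that(2) 4 pq by (cases "Suc q < m + m'") linarith+
      ultimately show ?thesis using ab' pq unfolding a b by auto
    qed
    moreover have "a' = a \<and> b' = b" if "\<not> m - a' \<le> p" "m + m' - b' \<le> q"
    proof -
      have "m - a' = Suc p" using that(1) 2 pq by (cases "Suc p < m") linarith+
      moreover have "m + m' - b' = q" using that(2) 3 ab' pq by (cases "m < q") linarith+
      ultimately show ?thesis using ab' pq unfolding a b by auto
    qed
    ultimately show False using ne by auto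
  qed
  then show ?thesis
    using ev_givens_mux[of p q ?cs ?x] window_ok[OF pq] unfolding len
    by (auto simp: wdb_block_def Let_def p_def[symmetric] q_def[symmetric])
qed

lemma ev_wdb_block_split:
  assumes ab: "a < m" "1 \<le> b" "b \<le> m'"
  shows "ev (m + m') (wdb_block m m' \<theta> (a, b)) (ket (unary m a @ unary m' b)) = (\<lambda>y.
     complex_of_real (cos (\<theta> (a, b))) * ket (unary m a @ unary m' b) y +
     complex_of_real (sin (\<theta> (a, b))) * ket (unary m (Suc a) @ unary m' (b - 1)) y)"
proof -
  let ?x = "unary m a @ unary m' b"
  define p q where "p = m - Suc a" and "q = m + m' - b"
  let ?cs = "window m (m + m') p q"
  have pq: "p < m" "m \<le> q" "q < m + m'" using ab by (auto simp: p_def q_def)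
  have len: "length ?x = m + m'" using ab by simp
  have x: "?x ! i = (if i < m then m - a \<le> i else m + m' - b \<le> i)" if "i < m + m'" for i
    using nth_two_unary[of a m b m' i] ab that by auto
  have bits: "\<not> ?x ! p" "?x ! q" using x[of p] x[of q] pq ab by (auto simp: p_def q_def)
  have swap: "swap_bits p q ?x = unary m (Suc a) @ unary m' (b - 1)"
  proof (rule nth_equalityI)
    fix i assume "i < length (swap_bits p q ?x)"
    then have i: "i < m + m'" using len by simp
    show "swap_bits p q ?x ! i = (unary m (Suc a) @ unary m' (b - 1)) ! i"
      using nth_swap_bits[of p ?x q i] nth_two_unary[of "Suc a" m "b - 1" m' i] x[OF i] bits pq len i ab
      by (auto simp: p_def q_def)
  qed (use ab in simp)
  have "ev (length ?x) (givens_mux p q ?cs (\<lambda>z. if z = restrict_bits ?x ?cs then \<theta> (a, b) else 0)) (ket ?x) = (\<lambda>y.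
     complex_of_real (cos (\<theta> (a, b))) * ket ?x y +
     complex_of_real (sin (\<theta> (a, b))) * ket (unary m (Suc a) @ unary m' (b - 1)) y)"
    using window_ok[OF pq] bits ab by (subst ev_givens_mux) (auto simp: swap)
  then show ?thesis unfolding len
    by (simp add: wdb_block_def Let_def p_def[symmetric] q_def[symmetric])
qed

section \<open>Chains of rotations at fixed total weight\<close>

definition tail_norm :: "nat \<Rightarrow> (nat \<Rightarrow> real) \<Rightarrow> nat \<Rightarrow> real" where
  "tail_norm e \<beta> a = sqrt (\<Sum>i=a..e. (\<beta> i)\<^sup>2)"

text \<open>The rotation at \<open>a\<close> leaves the amplitude \<open>\<beta> a\<close> behind
  and passes the norm of the rest on to \<open>Suc a\<close>. Blocks of another total fix every
  state met, so only the order within the chain matters; the chains for different \<open>j\<close>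
  may be interleaved at will, which the schedule exploits.\<close>

lemma ev_wdb_chain:
  fixes \<beta> :: "nat \<Rightarrow> real"
  assumes e_def: "e = min j m" and xs: "\<And>a b. (a, b) \<in> set xs \<Longrightarrow> a < m \<and> 1 \<le> b \<and> b \<le> m'"
    and chain: "filter (\<lambda>(a, b). a + b = j) xs = map (\<lambda>a. (a, j - a)) [a..<e]"
    and a: "a \<le> e" "j - a \<le> m'"
    and \<beta>: "\<And>i. 0 \<le> \<beta> i"
    and \<theta>: "\<And>a b. a + b = j \<Longrightarrow> \<theta> (a, b) = angle (tail_norm e \<beta> a) (\<beta> a) (tail_norm e \<beta> (Suc a))"
  shows "tail_norm e \<beta> a * ev (m + m') (concat (map (wdb_block m m' \<theta>) xs)) (ket (unary m a @ unary m' (j - a))) y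
     = (\<Sum>i=a..e. complex_of_real (\<beta> i) * ket (unary m i @ unary m' (j - i)) y)"
  using xs chain a
proof (induction xs arbitrary: a)
  case Nil
  then have "a = e" by auto
  then show ?case using Nil \<beta> by (simp add: tail_norm_def e_def)
next
  case (Cons x xs)
  obtain a' b' where x: "x = (a', b')" by (cases x)
  have v: "a' < m" "1 \<le> b'" "b' \<le> m'" using Cons.prems(1) x by auto
  have le: "a \<le> m" "a \<le> j" using Cons.prems(3) by (auto simp: e_def)
  have off: "ev (m + m') (wdb_block m m' \<theta> (a'', b'')) (ket (unary m a @ unary m' (j - a)))
      = ket (unary m a @ unary m' (j - a))"
    if "(a'', b'') \<in> set (x # xs)" "a'' + b'' \<noteq> j \<or> a < a''" for a'' b''
    using Cons.prems(1)[OF that(1)] that(2) le Cons.prems(4)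
    by (intro ev_wdb_block_fixed) auto
  show ?case
  proof (cases "a' + b' = j")
    case False
    then have "filter (\<lambda>(a, b). a + b = j) xs = map (\<lambda>a. (a, j - a)) [a..<e]"
      using Cons.prems(2) x by simp
    then have "tail_norm e \<beta> a * ev (m + m') (concat (map (wdb_block m m' \<theta>) xs)) (ket (unary m a @ unary m' (j - a))) y
        = (\<Sum>i=a..e. complex_of_real (\<beta> i) * ket (unary m i @ unary m' (j - i)) y)"
      by (intro Cons.IH) (use Cons.prems in auto)
    moreover have "ev (m + m') (wdb_block m m' \<theta> x) (ket (unary m a @ unary m' (j - a)))
        = ket (unary m a @ unary m' (j - a))"
      unfolding x by (rule off) (use x False in auto)
    ultimately show ?thesis by (simp add: ev_append)
  next
    case True
    then have f: "x # filter (\<lambda>(a, b). a + b = j) xs = map (\<lambda>a. (a, j - a)) [a..<e]"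
      using Cons.prems(2) x by simp
    then have ae: "a < e" by (cases "a < e") auto
    then have xa: "x = (a, j - a)" and rest: "filter (\<lambda>(a, b). a + b = j) xs = map (\<lambda>a. (a, j - a)) [Suc a..<e]"
      using f by (auto simp: upt_conv_Cons)
    have later: "a < a''" if "(a'', b'') \<in> set xs" "a'' + b'' = j" for a'' b''
    proof -
      have "(a'', b'') \<in> set (filter (\<lambda>(a, b). a + b = j) xs)" using that by simp
      then show ?thesis unfolding rest by auto
    qed
    \<comment> \<open>The component left at \<open>a\<close> is final: the remaining blocks have
      another total or a larger first index.\<close>
    have stay: "ev (m + m') (concat (map (wdb_block m m' \<theta>) xs)) (ket (unary m a @ unary m' (j - a)))
        = ket (unary m a @ unary m' (j - a))"
    proof (rule ev_fixed)
      fix z assume z: "z \<in> set xs"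
      obtain a'' b'' where zz: "z = (a'', b'')" by (cases z)
      show "ev (m + m') (wdb_block m m' \<theta> z) (ket (unary m a @ unary m' (j - a)))
        = ket (unary m a @ unary m' (j - a))"
        unfolding zz by (rule off) (use z zz later in auto)
    qed (use le Cons.prems(4) in simp)
    have IH: "tail_norm e \<beta> (Suc a) * ev (m + m') (concat (map (wdb_block m m' \<theta>) xs)) (ket (unary m (Suc a) @ unary m' (j - Suc a))) y
       = (\<Sum>i=Suc a..e. complex_of_real (\<beta> i) * ket (unary m i @ unary m' (j - i)) y)"
      by (rule Cons.IH) (use Cons.prems rest ae in auto)
    have sum: "(\<Sum>i=a..e. g i) = g a + (\<Sum>i=Suc a..e. g i)" for g :: "nat \<Rightarrow> 'z::comm_monoid_add"
      using ae by (simp add: sum.atLeast_Suc_atMost)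
    have "(tail_norm e \<beta> a)\<^sup>2 = (\<beta> a)\<^sup>2 + (tail_norm e \<beta> (Suc a))\<^sup>2"
      unfolding tail_norm_def by (simp add: sum_nonneg sum)
    moreover have "0 \<le> tail_norm e \<beta> a" by (simp add: tail_norm_def sum_nonneg)
    ultimately have t: "tail_norm e \<beta> a * cos (\<theta> (a, j - a)) = \<beta> a"
      "tail_norm e \<beta> a * sin (\<theta> (a, j - a)) = tail_norm e \<beta> (Suc a)"
      using angle \<theta>[of a "j - a"] le by auto
    have "ev (m + m') (concat (map (wdb_block m m' \<theta>) (x # xs))) (ket (unary m a @ unary m' (j - a))) y
      = complex_of_real (cos (\<theta> (a, j - a))) * ket (unary m a @ unary m' (j - a)) y +
        complex_of_real (sin (\<theta> (a, j - a))) *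
          ev (m + m') (concat (map (wdb_block m m' \<theta>) xs)) (ket (unary m (Suc a) @ unary m' (j - Suc a))) y"
      using ev_wdb_block_split[of a m "j - a" m' \<theta>] v xa x
      by (simp add: ev_append ev_add stay)
    then have "tail_norm e \<beta> a * ev (m + m') (concat (map (wdb_block m m' \<theta>) (x # xs))) (ket (unary m a @ unary m' (j - a))) y
      = complex_of_real (tail_norm e \<beta> a * cos (\<theta> (a, j - a))) * ket (unary m a @ unary m' (j - a)) y +
        complex_of_real (tail_norm e \<beta> a * sin (\<theta> (a, j - a))) *
          ev (m + m') (concat (map (wdb_block m m' \<theta>) xs)) (ket (unary m (Suc a) @ unary m' (j - Suc a))) y"
      by (simp add: algebra_simps)
    then show ?thesis unfolding t IH sum .
  qed
qed

text \<open>A chain step from (a, b) to (a + 1, b - 1) raises the slot by 3 + 4 = 7, so sorting by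
  slot respects the chains. The subtraction is exact for the blocks used, which have b \<le>
  k.\<close>

definition slot :: "nat \<Rightarrow> nat \<times> nat \<Rightarrow> nat" where
  "slot k = (\<lambda>(a, b). 3 * a + 4 * (k - b))"

definition wdb_order :: "nat \<Rightarrow> nat \<Rightarrow> nat \<Rightarrow> (nat \<times> nat) list" where
  "wdb_order m m' k = sort_key (slot k)
     (filter (\<lambda>(a, b). a < m \<and> b \<le> m') (List.product [0..<k] [1..<Suc k]))"

lemma set_wdb_order: "(a, b) \<in> set (wdb_order m m' k) \<longleftrightarrow> a < m \<and> a < k \<and> 1 \<le> b \<and> b \<le> m' \<and> b \<le> k"
  by (auto simp: wdb_order_def)

lemma distinct_wdb_order: "distinct (wdb_order m m' k)"
  by (simp add: wdb_order_def distinct_product)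

lemma sorted_wdb_order: "sorted (map (slot k) (wdb_order m m' k))"
  by (simp add: wdb_order_def)

lemma length_wdb_order: "length (wdb_order m m' k) \<le> k * k"
  using length_filter_le[of "\<lambda>(a, b). a < m \<and> b \<le> m'" "List.product [0..<k] [1..<Suc k]"]
  by (simp add: wdb_order_def length_product del: upt_Suc)

text \<open>Slots are injective on a chain, so two lists with the same members, both sorted by slot,
  coincide. The lower end \<open>j - m'\<close> is 0 when all ones fit into the right child.\<close>

lemma filter_wdb_order:
  assumes "j \<le> k"
  shows "filter (\<lambda>(a, b). a + b = j) (wdb_order m m' k) = map (\<lambda>a. (a, j - a)) [j - m'..<min j m]"
    (is "?X = ?Y")
proof -
  have set: "set ?X = set ?Y"
    using assms by (force simp: set_wdb_order)
  have inj: "inj_on (slot k) (set ?Y)"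
    using assms by (auto simp: inj_on_def slot_def)
  have "sorted (map (slot k) ?Y)"
    using assms unfolding sorted_wrt_map map_map
    by (intro sorted_wrt_mono_rel[OF _ sorted_wrt_upt]) (auto simp: slot_def)
  moreover have "distinct (map (slot k) ?Y)"
    using inj by (simp add: distinct_map inj_on_def)
  moreover have "sorted (map (slot k) ?X)"
    by (rule sorted_filter) (rule sorted_wdb_order)
  moreover have "distinct (map (slot k) ?X)"
    using inj unfolding set[symmetric] distinct_map by (simp add: distinct_wdb_order)
  ultimately have "map (slot k) ?X = map (slot k) ?Y"
    by (intro sorted_distinct_set_unique) (simp_all only: set_map set)
  moreover have "inj_on (slot k) (set ?X \<union> set ?Y)" using inj by (simp only: set Un_absorb)
  ultimately show ?thesis using inj_on_map_eq_map by blast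
qed

definition wdb_circuit :: "nat \<Rightarrow> nat \<Rightarrow> nat \<Rightarrow> (nat \<Rightarrow> nat \<Rightarrow> real) \<Rightarrow> circuit" where
  "wdb_circuit m m' k \<beta> = concat (map (wdb_block m m' (\<lambda>(a, b).
     let j = a + b; t = tail_norm (min j m) (\<beta> j) in angle (t a) (\<beta> j a) (t (Suc a)))) (wdb_order m m' k))"

lemma run_wdb_circuit:
  assumes j: "j \<le> k" "j \<le> m + m'" and y: "length y = m + m'"
    and \<beta>: "\<And>i. 0 \<le> \<beta> j i"
    and norm: "(\<Sum>i\<in>{i. i \<le> j \<and> i \<le> m \<and> j - i \<le> m'}. (\<beta> j i)\<^sup>2) = 1"
  shows "run (wdb_circuit m m' k \<beta>) (ket (unary (m + m') j)) y =
    (\<Sum>i\<in>{i. i \<le> j \<and> i \<le> m \<and> j - i \<le> m'}. complex_of_real (\<beta> j i) * ket (unary m i @ unary m' (j - i)) y)"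
proof -
  have range: "{i. i \<le> j \<and> i \<le> m \<and> j - i \<le> m'} = {j - m'..min j m}" by auto
  have t1: "tail_norm (min j m) (\<beta> j) (j - m') = 1"
    using norm unfolding range tail_norm_def by simp
  \<comment> \<open>The input fills the right child first, so it is the initial state of the
    chain.\<close>
  have u: "unary (m + m') j = unary m (j - m') @ unary m' (j - (j - m'))"
  proof (rule nth_equalityI)
    fix i assume "i < length (unary (m + m') j)"
    then have i: "i < m + m'" using j by simp
    show "unary (m + m') j ! i = (unary m (j - m') @ unary m' (j - (j - m'))) ! i"
      using nth_two_unary[of "j - m'" m "j - (j - m')" m' i] nth_unary[of j "m + m'" i] i j by auto
  qed (use j in simp)
  have "tail_norm (min j m) (\<beta> j) (j - m') * ev (m + m') (wdb_circuit m m' k \<beta>) (ket (unary m (j - m') @ unary m' (j - (j - m')))) y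
     = (\<Sum>i=j - m'..min j m. complex_of_real (\<beta> j i) * ket (unary m i @ unary m' (j - i)) y)"
    unfolding wdb_circuit_def
  proof (rule ev_wdb_chain[OF refl])
    show "filter (\<lambda>(a, b). a + b = j) (wdb_order m m' k) = map (\<lambda>a. (a, j - a)) [j - m'..<min j m]"
      by (rule filter_wdb_order) (rule j)
  qed (use j \<beta> in \<open>auto simp: set_wdb_order Let_def\<close>)
  then show ?thesis unfolding t1 u range using y by (simp add: ev_def)
qed

text \<open>A multiplexer with at most four controls has at most 3 * 2^4 = 48 gates; this count also
  serves as its depth bound.\<close>

lemma wdb_block_ok:
  assumes "a < m" "1 \<le> b" "b \<le> m'"
  shows "valid_circuit (m + m') (wdb_block m m' \<theta> (a, b))"
    "fits (wdb_qubits m m' (a, b)) 48 (wdb_block m m' \<theta> (a, b))"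
    "wdb_qubits m m' (a, b) \<subseteq> {..<m + m'}"
    "length (wdb_block m m' \<theta> (a, b)) \<le> 48"
proof -
  define p q where "p = m - Suc a" and "q = m + m' - b"
  let ?cs = "window m (m + m') p q"
  have pq: "p < m" "m \<le> q" "q < m + m'" using assms by (auto simp: p_def q_def)
  obtain \<theta>' where eq: "wdb_block m m' \<theta> (a, b) = givens_mux p q ?cs \<theta>'"
    by (simp add: wdb_block_def Let_def p_def q_def)
  have S: "wdb_qubits m m' (a, b) = set (p # q # ?cs)"
    by (simp add: wdb_qubits_def Let_def p_def q_def)
  show "valid_circuit (m + m') (wdb_block m m' \<theta> (a, b))"
    unfolding eq by (intro valid_givens_mux window_ok pq)
  show "wdb_qubits m m' (a, b) \<subseteq> {..<m + m'}"
    unfolding S by (intro window_ok pq)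
  have "3 * 2 ^ length ?cs \<le> (3 * 2 ^ 4 :: nat)"
    using length_window by (intro mult_le_mono2 power_increasing) auto
  then show len: "length (wdb_block m m' \<theta> (a, b)) \<le> 48"
    unfolding eq by (intro order_trans[OF length_givens_mux]) simp
  have "fits (set (p # q # ?cs)) (length (wdb_block m m' \<theta> (a, b))) (wdb_block m m' \<theta> (a, b))"
    unfolding eq by (intro fits_length ballI) (rule qubits_givens_mux)
  then show "fits (wdb_qubits m m' (a, b)) 48 (wdb_block m m' \<theta> (a, b))"
    unfolding S by (rule fits_mono[OF _ subset_refl len])
qed

text \<open>
  If \<open>3a - 4b\<close> agrees for two blocks, then \<open>4\<close> divides the difference of the \<open>a\<close> and \<open>3\<close> that of the
  \<open>b\<close>, so the windows, which have width 3, are disjoint.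
\<close>

lemma wdb_qubits_disjoint:
  assumes "a < m" "1 \<le> b" "b \<le> m'" "b \<le> k" "a' < m" "1 \<le> b'" "b' \<le> m'" "b' \<le> k"
    and slot: "slot k (a, b) = slot k (a', b')" and ne: "(a, b) \<noteq> (a', b')"
  shows "wdb_qubits m m' (a, b) \<inter> wdb_qubits m m' (a', b') = {}"
proof -
  \<comment> \<open>Position \<open>i\<close> is within distance 1 of p on the left or of q on the
    right, written additively to avoid truncated subtraction.\<close>
  have sub: "i < m \<and> m \<le> i + a + 2 \<and> i + a \<le> m \<or> m \<le> i \<and> m + m' \<le> i + b + 1 \<and> i + b \<le> m + m' + 1"
    if "a < m" "1 \<le> b" "b \<le> m'" "i \<in> wdb_qubits m m' (a, b)" for a b i
    using that by (auto simp: wdb_qubits_def window_def Let_def split: if_splits)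
  have eq: "3 * a + 4 * b' = 3 * a' + 4 * b"
    using slot assms by (simp add: slot_def)
  have "a + 4 \<le> a' \<and> b + 3 \<le> b'" if "a < a'"
    using eq that by presburger
  moreover have "a' + 4 \<le> a \<and> b' + 3 \<le> b" if "a' < a"
    using eq that by presburger
  moreover have "a \<noteq> a'" using eq ne by auto
  ultimately have far: "a + 4 \<le> a' \<and> b + 3 \<le> b' \<or> a' + 4 \<le> a \<and> b' + 3 \<le> b"
    using linorder_neq_iff[of a a'] by blast
  have False if "i \<in> wdb_qubits m m' (a, b)" "i \<in> wdb_qubits m m' (a', b')" for i
    using sub[OF assms(1-3) that(1)] sub[OF assms(5-7) that(2)]
    by (elim disjE conjE; insert far; elim disjE conjE; linarith)
  then show ?thesis by blast
qed

text \<open>All slots lie below 3k + 4k, and a slot has depth 48, whence 336 = 48 * 7. The gate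
  count comes from at most k * k blocks.\<close>

lemma wdb_circuit_ok:
  shows "valid_circuit (m + m') (wdb_circuit m m' k \<beta>)"
    and "length (wdb_circuit m m' k \<beta>) \<le> 48 * k * k"
    and "fits {..<m + m'} (336 * k) (wdb_circuit m m' k \<beta>)"
proof -
  have v: "a < m \<and> 1 \<le> b \<and> b \<le> m' \<and> b \<le> k \<and> a < k" if "(a, b) \<in> set (wdb_order m m' k)" for a b
    using that by (auto simp: set_wdb_order)
  show "valid_circuit (m + m') (wdb_circuit m m' k \<beta>)"
    unfolding wdb_circuit_def valid_circuit_concat using wdb_block_ok(1) v by fast
  have "length (wdb_circuit m m' k \<beta>) \<le> length (wdb_order m m' k) * 48"
    unfolding wdb_circuit_def using wdb_block_ok(4) v by (intro length_concat_le) fast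
  also have "\<dots> \<le> k * k * 48" by (intro mult_le_mono1 length_wdb_order)
  finally show "length (wdb_circuit m m' k \<beta>) \<le> 48 * k * k" by simp
  have sorted: "sorted_wrt (\<lambda>x y. wdb_qubits m m' x \<inter> wdb_qubits m m' y \<noteq> {} \<longrightarrow> slot k x < slot k y) (wdb_order m m' k)"
    unfolding sorted_wrt_iff_nth_less
  proof (intro allI impI)
    fix i j
    let ?x = "wdb_order m m' k ! i" and ?y = "wdb_order m m' k ! j"
    assume ij: "i < j" "j < length (wdb_order m m' k)" and meet: "wdb_qubits m m' ?x \<inter> wdb_qubits m m' ?y \<noteq> {}"
    have mem: "?x \<in> set (wdb_order m m' k)" "?y \<in> set (wdb_order m m' k)" using ij by auto
    have "?x \<noteq> ?y" using ij distinct_wdb_order by (simp add: nth_eq_iff_index_eq)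
    moreover have "slot k ?x \<le> slot k ?y"
      using sorted_nth_mono[OF sorted_wdb_order, of i j k m m'] ij by simp
    \<comment> \<open>Sorting only gives a weak inequality; equality is excluded since distinct
      blocks of one slot are disjoint.\<close>
    ultimately show "slot k ?x < slot k ?y"
      using wdb_qubits_disjoint[of "fst ?x" m "snd ?x" m' k "fst ?y" "snd ?y"] meet
        v[of "fst ?x" "snd ?x"] v[of "fst ?y" "snd ?y"] mem by (auto simp: order.order_iff_strict)
  qed
  have "fits {..<m + m'} (48 * (7 * k)) (wdb_circuit m m' k \<beta>)"
    unfolding wdb_circuit_def
  proof (rule fits_wavefront[OF _ _ _ sorted])
    fix x assume x: "x \<in> set (wdb_order m m' k)"
    obtain a b where ab: "x = (a, b)" by (cases x)
    show "fits (wdb_qubits m m' x) 48 (wdb_block m m' (\<lambda>(a, b).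
       let j = a + b; t = tail_norm (min j m) (\<beta> j) in angle (t a) (\<beta> j a) (t (Suc a))) x)"
      and "wdb_qubits m m' x \<subseteq> {..<m + m'}"
      using wdb_block_ok(2,3)[of a m b m'] v x ab by auto
    show "slot k x < 7 * k"
      using v[of a b] x unfolding ab slot_def by auto
  qed
  then show "fits {..<m + m'} (336 * k) (wdb_circuit m m' k \<beta>)" by simp
qed


section \<open>The algorithm\<close>

definition flip_circuit :: "nat list \<Rightarrow> circuit" where
  "flip_circuit qs = map (\<lambda>q. ([q], pauli_x)) qs"

lemma apply_pauli_x_ket:
  assumes "q < length z"
  shows "apply_on [q] pauli_x (ket z) = ket (z[q := (\<not> z ! q)])"
proof
  fix b
  have "b[q := (\<not> b ! q)] = z \<longleftrightarrow> b = z[q := (\<not> z ! q)]"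
    using assms by auto
  then show "apply_on [q] pauli_x (ket z) b = ket (z[q := (\<not> z ! q)]) b"
    by (simp add: apply_pauli_x ket_def)
qed

lemma run_flip_circuit:
  assumes "distinct qs" "set qs \<subseteq> {..<length z}" "length y = length z"
    "\<And>i. i < length z \<Longrightarrow> y ! i \<longleftrightarrow> (i \<in> set qs) \<noteq> z ! i"
  shows "run (flip_circuit qs) (ket z) = ket y"
  using assms
proof (induction qs arbitrary: z)
  case Nil
  then have "y = z" by (intro nth_equalityI) auto
  then show ?case by (simp add: flip_circuit_def)
next
  case (Cons q qs)
  have "run (flip_circuit qs) (ket (z[q := (\<not> z ! q)])) = ket y"
    by (rule Cons.IH) (use Cons.prems in \<open>auto simp: nth_list_update\<close>)
  then show ?case using Cons.prems(2) by (simp add: flip_circuit_def apply_pauli_x_ket)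
qed

lemma prepares_flip_circuit:
  assumes "l \<le> n"
  shows "prepares n a (unary n l) (flip_circuit [n - l..<n])"
proof -
  have "run (flip_circuit [n - l..<n]) (ket (zeros (n + a))) = ket (unary n l @ zeros a)"
    by (rule run_flip_circuit) (use assms in \<open>auto simp: zeros_def nth_append nth_unary\<close>)
  moreover have "valid_circuit (n + a) (flip_circuit [n - l..<n])"
    by (auto simp: valid_circuit_def valid_gate_def flip_circuit_def unitary_pauli_x)
  ultimately show ?thesis by (simp add: prepares_def)
qed

lemma two_qubit_gates_append: "two_qubit_gates (C @ D) = two_qubit_gates C + two_qubit_gates D"
  by (simp add: two_qubit_gates_def)

lemma two_qubit_gates_flip_circuit: "two_qubit_gates (flip_circuit qs) = 0"
  by (auto simp: two_qubit_gates_def flip_circuit_def)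

lemma fits_flip_circuit: "set qs \<subseteq> S \<Longrightarrow> fits S (length qs) (flip_circuit qs)"
  using fits_length[of "flip_circuit qs" S] by (auto simp: flip_circuit_def)

section \<open>Levels, nodes and leaves of the partition tree\<close>

fun height :: "ptree \<Rightarrow> nat" where
  "height (Leaf Q) = 0"
| "height (Node l r) = Suc (max (height l) (height r))"

text \<open>The preorder lists the whole left subtree before the right one, but the two act on
  disjoint qubits and so run in parallel: each level costs the depth of one block.\<close>

lemma fits_tree:
  assumes "\<And>v. v \<in> set (internal_nodes t) \<Longrightarrow> fits (set (node_qubits v)) d (C v)"
    and "distinct (qubits t)"
  shows "fits (set (qubits t)) (d * height t) (concat (map C (internal_nodes t)))"
  using assms
proof (induction t)
  case (Leaf Q)
  then show ?case by (simp add: fits_Nil)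
next
  case (Node l r)
  let ?h = "d * max (height l) (height r)"
  have "fits (set (qubits l)) (d * height l) (concat (map C (internal_nodes l)))"
    "fits (set (qubits r)) (d * height r) (concat (map C (internal_nodes r)))"
    using Node by auto
  then have "fits (set (qubits l)) ?h (concat (map C (internal_nodes l)))"
    "fits (set (qubits r)) ?h (concat (map C (internal_nodes r)))"
    by (auto elim!: fits_mono)
  then have "fits (set (qubits l) \<union> set (qubits r)) ?h
      (concat (map C (internal_nodes l)) @ concat (map C (internal_nodes r)))"
    using Node.prems(2) by (intro fits_par) auto
  moreover have "fits (set (qubits l) \<union> set (qubits r)) d (C (qubits l, qubits r))"
    using Node.prems(1)[of "(qubits l, qubits r)"] by (simp add: node_qubits_def)
  ultimately have "fits (set (qubits l) \<union> set (qubits r)) (d + ?h)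
     (C (qubits l, qubits r) @ concat (map C (internal_nodes l)) @ concat (map C (internal_nodes r)))"
    by (intro fits_append)
  then show ?case by simp
qed

lemma internal_node_qubits:
  assumes "v \<in> set (internal_nodes t)" "distinct (qubits t)"
  shows "distinct (node_qubits v) \<and> set (node_qubits v) \<subseteq> set (qubits t)"
  using assms by (induction t) (auto simp: node_qubits_def)

lemma qubits_build: "qubits (build cs) = concat cs"
proof (induction cs rule: build.induct)
  case (3 Q Q' Qs)
  let ?cs = "Q # Q' # Qs" and ?h = "length (Q # Q' # Qs) div 2"
  have "qubits (build ?cs) = concat (take ?h ?cs) @ concat (drop ?h ?cs)"
    using 3[OF refl refl] by (simp add: Let_def)
  then show ?case by (metis append_take_drop_id concat_append)
qed simp_all

lemma length_internal_nodes_build: "cs \<noteq> [] \<Longrightarrow> Suc (length (internal_nodes (build cs))) = length cs"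
proof (induction cs rule: build.induct)
  case (3 Q Q' Qs)
  let ?cs = "Q # Q' # Qs" and ?h = "length (Q # Q' # Qs) div 2"
  have h: "1 \<le> ?h" "?h < length ?cs" by auto
  have "take ?h ?cs \<noteq> []" "drop ?h ?cs \<noteq> []" using h by auto
  then have "Suc (length (internal_nodes (build (take ?h ?cs)))) = length (take ?h ?cs)"
    "Suc (length (internal_nodes (build (drop ?h ?cs)))) = length (drop ?h ?cs)"
    using "3.IH"[OF refl refl] by blast+
  moreover have "length (take ?h ?cs) + length (drop ?h ?cs) = length ?cs"
    by (metis append_take_drop_id length_append)
  moreover have "length (internal_nodes (build ?cs))
      = Suc (length (internal_nodes (build (take ?h ?cs))) + length (internal_nodes (build (drop ?h ?cs))))"
    by (simp add: Let_def)
  ultimately show ?case by linarith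
qed simp_all

text \<open>Half of at most 2^(h + 1) chunks, rounded either way, is at most 2^h.\<close>

lemma height_build: "length cs \<le> 2 ^ h \<Longrightarrow> height (build cs) \<le> h"
proof (induction cs arbitrary: h rule: build.induct)
  case (3 Q Q' Qs)
  let ?cs = "Q # Q' # Qs" and ?h = "length (Q # Q' # Qs) div 2"
  from 3(3) obtain h' where h': "h = Suc h'" by (cases h) auto
  have "length (take ?h ?cs) \<le> 2 ^ h'" "length (drop ?h ?cs) \<le> 2 ^ h'"
    using 3(3) unfolding h' by auto
  then have "height (build (take ?h ?cs)) \<le> h'" "height (build (drop ?h ?cs)) \<le> h'"
    using 3(1,2)[OF refl refl] by blast+
  then show ?case by (simp add: h' Let_def)
qed simp_all

text \<open>Rounding up adds less than 1 to n / k, so \<open>num_leaves n k * k\<close> exceeds n by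
  less than k < n. Hence the factor 2, which later turns counts per leaf into bounds in n.\<close>

lemma num_leaves_bounds:
  assumes "0 < k" "k < n"
  shows "n \<le> num_leaves n k * k" "u < num_leaves n k \<Longrightarrow> u * k < n" "0 < num_leaves n k"
    "real (num_leaves n k) * real k \<le> 2 * real n"
proof -
  let ?G = "num_leaves n k"
  have pos: "0 < real n / real k" using assms by simp
  then have G: "real ?G = of_int \<lceil>real n / real k\<rceil>" by (simp add: num_leaves_def)
  have "real n / real k \<le> real ?G" unfolding G by (rule le_of_int_ceiling)
  then have le: "real n \<le> real ?G * real k" using assms by (simp add: field_simps)
  then show "n \<le> ?G * k" by (metis of_nat_le_iff of_nat_mult)
  show "0 < ?G" using le assms by (cases "?G = 0") auto
  have "real ?G < real n / real k + 1" unfolding G by linarith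
  then have lt: "real ?G * real k < real n + real k" using assms by (simp add: field_simps)
  then show "real ?G * real k \<le> 2 * real n" using assms by simp
  show "u * k < n" if "u < ?G"
  proof -
    have "(real u + 1) * real k \<le> real ?G * real k" using that by (intro mult_right_mono) auto
    then have "real (u * k) < real n" using lt by (simp add: algebra_simps)
    then show ?thesis by (simp only: of_nat_less_iff)
  qed
qed

lemma concat_leaf: "concat (map (leaf n k) [0..<g]) = [0..<min n (g * k)]"
proof (induction g)
  case (Suc g)
  then show ?case
    using upt_add_eq_append[of 0 "g * k" "min n (Suc g * k) - g * k"]
    by (cases "g * k \<le> n") (auto simp: leaf_def min_def)
qed simp

lemma concat_leaf_num_leaves:
  assumes "0 < k" "k < n"
  shows "concat (map (leaf n k) [0..<num_leaves n k]) = [0..<n]"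
  using num_leaves_bounds(1)[OF assms] by (simp add: concat_leaf min_absorb1)

lemma is_gWDB_wdb_circuit:
  assumes v: "v = (ps, qs)"
  shows "is_gWDB n k \<alpha> v (circuit_op (wdb_circuit (length ps) (length qs) k (node_coeff n \<alpha> v)))"
proof -
  let ?m = "length ps" and ?m' = "length qs"
  let ?C = "wdb_circuit ?m ?m' k (node_coeff n \<alpha> v)"
  have "circuit_op ?C y (unary (?m + ?m') j) = (\<Sum>i\<in>{i. i \<le> j \<and> i \<le> ?m \<and> j - i \<le> ?m'}.
      complex_of_real (node_coeff n \<alpha> v j i) * ket (unary ?m i @ unary ?m' (j - i)) y)"
    if j: "j \<le> k" "j \<le> ?m + ?m'" and amp: "node_amp n \<alpha> v j \<noteq> 0" and y: "length y = ?m + ?m'" for j y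
    unfolding circuit_op_def
  proof (rule run_wdb_circuit[OF j y])
    let ?I = "{i. i \<le> j \<and> i \<le> ?m \<and> j - i \<le> ?m'}"
    show "0 \<le> node_coeff n \<alpha> v j i" for i
      by (auto simp: node_coeff_def split_amp_def node_amp_def intro!: divide_nonneg_nonneg sum_nonneg)
    \<comment> \<open>A child cannot hold more ones than qubits, so the admissible \<open>i\<close>
      already carry the full norm.\<close>
    have zero: "split_amp n \<alpha> v i (j - i) = 0" if "i \<in> {..j} - ?I" for i
    proof -
      have "\<not> (hw (restrict_bits b ps) = i \<and> hw (restrict_bits b qs) = j - i)" for b
        using that hw_le_length[of "restrict_bits b ps"] hw_le_length[of "restrict_bits b qs"] by auto
      then have "{b \<in> bitstrings n. hw (restrict_bits b ps) = i \<and> hw (restrict_bits b qs) = j - i} = {}"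
        by blast
      then show ?thesis by (simp only: split_amp_def v fst_conv snd_conv sum.empty real_sqrt_zero)
    qed
    have "(\<Sum>i\<in>?I. (split_amp n \<alpha> v i (j - i))\<^sup>2) = (\<Sum>i\<le>j. (split_amp n \<alpha> v i (j - i))\<^sup>2)"
      by (rule sum.mono_neutral_left) (use zero in auto)
    also have "\<dots> = (node_amp n \<alpha> v j)\<^sup>2"
      by (simp add: node_amp_def sum_nonneg)
    finally show "(\<Sum>i\<in>?I. (node_coeff n \<alpha> v j i)\<^sup>2) = 1"
      using amp by (simp add: node_coeff_def power_divide sum_divide_distrib[symmetric])
  qed
  then show ?thesis
    using unitary_circuit_op[OF wdb_circuit_ok(1)] v
    by (simp add: is_gWDB_def node_qubits_def Let_def)
qed

text \<open>A nonzero sector norm provides the reference string. Its own bits on the leaf have ratio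
  1, so the normalising sum is at least 1 and the division is genuine.\<close>

lemma leaf_coeff_norm:
  assumes k: "0 < k" "k < n" and u: "u < num_leaves n k" and sn: "sector_norm n k \<alpha> I \<noteq> 0"
  shows "(\<Sum>g\<in>{g \<in> bitstrings (leaf_size n k u). hw g = I ! u}. (cmod (leaf_coeff n k \<alpha> I u g))\<^sup>2) = 1"
proof -
  let ?B = "{b \<in> bitstrings n. leaf_weights n k b = I \<and> \<alpha> b \<noteq> 0}" and ?r = "ref_string n k \<alpha> I"
  let ?S = "{g \<in> bitstrings (leaf_size n k u). hw g = I ! u}" and ?R = "leaf_ratio n k \<alpha> I u"
  have "?B \<noteq> {}"
  proof
    assume "?B = {}"
    then have "(\<Sum>b\<in>{b \<in> bitstrings n. leaf_weights n k b = I}. (cmod (\<alpha> b))\<^sup>2) = 0"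
      by (intro sum.neutral) auto
    then show False using sn by (simp add: sector_norm_def)
  qed
  moreover have "finite ?B" by (rule finite_subset[OF _ finite_bitstrings[of n]]) auto
  ultimately have "?r \<in> ?B" unfolding ref_string_def by (rule Min_in[rotated])
  then have r: "length ?r = n" "leaf_weights n k ?r = I" "\<alpha> ?r \<noteq> 0" by auto
  let ?g = "restrict_bits ?r (leaf n k u)"
  have leaf: "distinct (leaf n k u)" "set (leaf n k u) \<subseteq> {..<length ?r}"
    using r(1) by (auto simp: leaf_def)
  have "leaf_weights n k ?r ! u = hw ?g" using u by (simp add: leaf_weights_def)
  then have "I ! u = hw ?g" using r(2) by simp
  then have g: "?g \<in> ?S" by (simp add: leaf_size_def)
  have "?R ?g = 1" using r(3) leaf by (simp add: leaf_ratio_def)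
  moreover have fin: "finite ?S" by (rule finite_subset[OF _ finite_bitstrings[of "leaf_size n k u"]]) auto
  ultimately have "1 \<le> (\<Sum>g\<in>?S. (cmod (?R g))\<^sup>2)"
    using member_le_sum[OF g, of "\<lambda>g. (cmod (?R g))\<^sup>2"] by simp
  then show ?thesis
    by (simp add: leaf_coeff_def norm_divide power_divide sum_divide_distrib[symmetric])
qed

text \<open>If no tuple has weight \<open>i\<close> at this leaf, \<open>the\<close> gives an
  unspecified vector; the encoder is unconstrained on that column.\<close>

definition leaf_amplitudes :: "nat \<Rightarrow> nat \<Rightarrow> state \<Rightarrow> nat list list \<Rightarrow> nat \<Rightarrow> nat \<Rightarrow> state" where
  "leaf_amplitudes n k \<alpha> Is u i = leaf_coeff n k \<alpha> (the (first_tuple n k \<alpha> Is u i)) u"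

lemma valid_circuit_qubits: "valid_circuit N C \<Longrightarrow> g \<in> set C \<Longrightarrow> set (fst g) \<subseteq> {..<N}"
  by (auto simp: valid_circuit_def valid_gate_def case_prod_beta)

lemma leaf_size_bounds:
  assumes "0 < k" "k < n" "u < num_leaves n k"
  shows "0 < leaf_size n k u" "leaf_size n k u \<le> k"
  using num_leaves_bounds(2)[OF assms] assms(1) by (auto simp: leaf_size_def leaf_def)

lemma is_leaf_encoder_leaf_circuit:
  assumes k: "0 < k" "k < n" and u: "u < num_leaves n k"
  shows "is_leaf_encoder n k l \<alpha> Is u
    (circuit_op (leaf_circuit (leaf_size n k u) (leaf_amplitudes n k \<alpha> Is u)))"
proof -
  let ?m = "leaf_size n k u" and ?\<eta> = "leaf_amplitudes n k \<alpha> Is u"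
  have "circuit_op (leaf_circuit ?m ?\<eta>) y (unary ?m i) = (if hw y = i then leaf_coeff n k \<alpha> I u y else 0)"
    if "i \<le> ?m" "first_tuple n k \<alpha> Is u i = Some I" "length y = ?m" for i I y
  proof -
    have I: "I ! u = i" "sector_norm n k \<alpha> I \<noteq> 0"
      using that(2) by (auto simp: first_tuple_def find_Some_iff)
    have \<eta>: "?\<eta> i = leaf_coeff n k \<alpha> I u" using that(2) by (simp add: leaf_amplitudes_def)
    show ?thesis unfolding circuit_op_def \<eta>[symmetric]
      by (rule run_leaf_circuit) (use that leaf_coeff_norm[OF k u I(2)] I(1) \<eta> in auto)
  qed
  then show ?thesis
    using unitary_circuit_op[OF valid_leaf_circuit] leaf_size_bounds(1)[OF assms]
    by (simp add: is_leaf_encoder_def)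
qed

section \<open>The full circuit and its resources\<close>

definition node_circuit :: "nat \<Rightarrow> nat \<Rightarrow> state \<Rightarrow> node \<Rightarrow> circuit" where
  "node_circuit n k \<alpha> v = wdb_circuit (length (fst v)) (length (snd v)) k (node_coeff n \<alpha> v)"

definition encoder_circuit :: "nat \<Rightarrow> nat \<Rightarrow> state \<Rightarrow> nat list list \<Rightarrow> nat \<Rightarrow> circuit" where
  "encoder_circuit n k \<alpha> Is u = leaf_circuit (leaf_size n k u) (leaf_amplitudes n k \<alpha> Is u)"

definition algorithm_circuit :: "nat \<Rightarrow> nat \<Rightarrow> nat \<Rightarrow> state \<Rightarrow> nat list list \<Rightarrow> circuit" where
  "algorithm_circuit n k l \<alpha> Is = flip_circuit [n - l..<n] @
     concat (map (\<lambda>v. relabel (node_qubits v) (node_circuit n k \<alpha> v)) (internal_nodes (partition_tree n k))) @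
     concat (map (\<lambda>u. relabel (leaf n k u) (encoder_circuit n k \<alpha> Is u)) [0..<num_leaves n k])"

context
  fixes n k l :: nat and \<alpha> :: state and Is :: "nat list list"
  assumes k: "0 < k" "k < n" and l: "l \<le> k"
begin

lemma qubits_partition_tree: "qubits (partition_tree n k) = [0..<n]"
  by (simp add: partition_tree_def qubits_build concat_leaf_num_leaves[OF k])

lemma node_ok:
  assumes "v \<in> set (internal_nodes (partition_tree n k))"
  shows "distinct (node_qubits v)" "set (node_qubits v) \<subseteq> {..<n}"
  using internal_node_qubits[OF assms] by (auto simp: qubits_partition_tree)

lemma leaf_ok: "distinct (leaf n k u)" "set (leaf n k u) \<subseteq> {..<n}"
  by (auto simp: leaf_def)

lemma valid_node_circuit: "valid_circuit (length (node_qubits v)) (node_circuit n k \<alpha> v)"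
  unfolding node_circuit_def node_qubits_def length_append by (rule wdb_circuit_ok)

lemma valid_encoder_circuit:
  "u < num_leaves n k \<Longrightarrow> valid_circuit (length (leaf n k u)) (encoder_circuit n k \<alpha> Is u)"
  unfolding encoder_circuit_def using valid_leaf_circuit leaf_size_bounds(1)[OF k]
  by (simp add: leaf_size_def)

text \<open>\<open>a\<close> is arbitrary, so the same circuit can be used with and without an
  ancilla register.\<close>

lemma implements_algorithm_circuit:
  "implements_algorithm n k l \<alpha> Is a (algorithm_circuit n k l \<alpha> Is)"
proof -
  let ?vs = "internal_nodes (partition_tree n k)" and ?G = "num_leaves n k"
  have "is_gWDB n k \<alpha> v (circuit_op (node_circuit n k \<alpha> v))" for v
    unfolding node_circuit_def using is_gWDB_wdb_circuit[of v "fst v" "snd v"] by simp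
  moreover have "is_leaf_encoder n k l \<alpha> Is u (circuit_op (encoder_circuit n k \<alpha> Is u))" if "u < ?G" for u
    unfolding encoder_circuit_def using is_leaf_encoder_leaf_circuit[OF k that] .
  moreover have "prepares n a (unary n l) (flip_circuit [n - l..<n])"
    using k l by (intro prepares_flip_circuit) simp
  moreover have "realizes n a (node_qubits v) (circuit_op (node_circuit n k \<alpha> v))
      (relabel (node_qubits v) (node_circuit n k \<alpha> v))" if "v \<in> set ?vs" for v
    by (intro realizes_relabel valid_node_circuit node_ok that)
  moreover have "realizes n a (leaf n k u) (circuit_op (encoder_circuit n k \<alpha> Is u))
      (relabel (leaf n k u) (encoder_circuit n k \<alpha> Is u))" if "u < ?G" for u
    by (intro realizes_relabel valid_encoder_circuit leaf_ok that)
  ultimately show ?thesis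
    unfolding implements_algorithm_def Let_def algorithm_circuit_def
    by (intro exI[of _ "\<lambda>v. circuit_op (node_circuit n k \<alpha> v)"]
        exI[of _ "\<lambda>u. circuit_op (encoder_circuit n k \<alpha> Is u)"]
        exI[of _ "flip_circuit [n - l..<n]"]
        exI[of _ "\<lambda>v. relabel (node_qubits v) (node_circuit n k \<alpha> v)"]
        exI[of _ "\<lambda>u. relabel (leaf n k u) (encoder_circuit n k \<alpha> Is u)"]) auto
qed

lemma length_encoder_circuit:
  assumes "u < num_leaves n k"
  shows "length (encoder_circuit n k \<alpha> Is u) \<le> 9 * 2 ^ k"
proof -
  have "9 * 2 ^ leaf_size n k u \<le> (9 * 2 ^ k :: nat)"
    using leaf_size_bounds(2)[OF k assms] by (intro mult_le_mono2 power_increasing) auto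
  then show ?thesis unfolding encoder_circuit_def by (rule order_trans[OF length_leaf_circuit])
qed

text \<open>The summands belong to the bit flips, to at most \<open>h\<close> tree levels of depth
  336k, and to the leaf encoders. The encoders run in parallel, each with its gate count as depth
  bound.\<close>

lemma fits_algorithm_circuit:
  assumes "num_leaves n k \<le> 2 ^ h"
  shows "fits {..<n} (l + (336 * k * h + 9 * 2 ^ k)) (algorithm_circuit n k l \<alpha> Is)"
  unfolding algorithm_circuit_def
proof (intro fits_append)
  let ?t = "partition_tree n k"
  show "fits {..<n} l (flip_circuit [n - l..<n])"
    using fits_flip_circuit[of "[n - l..<n]" "{..<n}"] k l by (simp add: subset_eq)
  have Q: "set (qubits ?t) = {..<n}" by (auto simp: qubits_partition_tree)
  have "fits (set (qubits ?t)) (336 * k * height ?t)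
     (concat (map (\<lambda>v. relabel (node_qubits v) (node_circuit n k \<alpha> v)) (internal_nodes ?t)))"
  proof (rule fits_tree)
    fix v assume v: "v \<in> set (internal_nodes ?t)"
    show "fits (set (node_qubits v)) (336 * k) (relabel (node_qubits v) (node_circuit n k \<alpha> v))"
      using wdb_circuit_ok(3)[of "length (fst v)" "length (snd v)" k "node_coeff n \<alpha> v"] node_ok[OF v]
      by (intro fits_relabel) (simp_all add: node_circuit_def node_qubits_def)
  qed (simp add: qubits_partition_tree)
  then show "fits {..<n} (336 * k * h)
     (concat (map (\<lambda>v. relabel (node_qubits v) (node_circuit n k \<alpha> v)) (internal_nodes ?t)))"
  proof (rule fits_mono)
    show "336 * k * height ?t \<le> 336 * k * h"
      using height_build[of "map (leaf n k) [0..<num_leaves n k]" h] assms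
      by (simp add: partition_tree_def)
  qed (simp add: Q)
  have "fits (\<Union>u\<in>set [0..<num_leaves n k]. set (leaf n k u)) (9 * 2 ^ k)
     (concat (map (\<lambda>u. relabel (leaf n k u) (encoder_circuit n k \<alpha> Is u)) [0..<num_leaves n k]))"
  proof (rule fits_concat_par)
    fix u assume "u \<in> set [0..<num_leaves n k]"
    then have u: "u < num_leaves n k" by simp
    have "fits {..<length (leaf n k u)} (length (encoder_circuit n k \<alpha> Is u)) (encoder_circuit n k \<alpha> Is u)"
      using valid_circuit_qubits[OF valid_encoder_circuit[OF u]] by (intro fits_length) blast
    then have "fits {..<length (leaf n k u)} (9 * 2 ^ k) (encoder_circuit n k \<alpha> Is u)"
      by (rule fits_mono) (use length_encoder_circuit[OF u] in auto)
    then show "fits (set (leaf n k u)) (9 * 2 ^ k) (relabel (leaf n k u) (encoder_circuit n k \<alpha> Is u))"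
      by (rule fits_relabel) (rule leaf_ok)
  next
    fix u u' :: nat assume "u \<noteq> u'"
    then consider "Suc u \<le> u'" | "Suc u' \<le> u" by linarith
    then have "Suc u * k \<le> u' * k \<or> Suc u' * k \<le> u * k"
      by cases (use mult_le_mono1 in blast)+
    then show "set (leaf n k u) \<inter> set (leaf n k u') = {}"
      by (auto simp: leaf_def)
  qed simp
  then show "fits {..<n} (9 * 2 ^ k)
     (concat (map (\<lambda>u. relabel (leaf n k u) (encoder_circuit n k \<alpha> Is u)) [0..<num_leaves n k]))"
    by (rule fits_mono) (use leaf_ok in auto)
qed

lemma two_qubit_gates_algorithm_circuit:
  "two_qubit_gates (algorithm_circuit n k l \<alpha> Is) \<le> num_leaves n k * (48 * k * k + 9 * 2 ^ k)"
proof -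
  let ?G = "num_leaves n k" and ?vs = "internal_nodes (partition_tree n k)"
  have "length (concat (map (\<lambda>v. relabel (node_qubits v) (node_circuit n k \<alpha> v)) ?vs)) \<le> length ?vs * (48 * k * k)"
    by (rule length_concat_le) (simp add: node_circuit_def wdb_circuit_ok)
  also have "\<dots> \<le> ?G * (48 * k * k)"
    using length_internal_nodes_build[of "map (leaf n k) [0..<?G]"] num_leaves_bounds(3)[OF k]
    by (intro mult_le_mono1) (simp add: partition_tree_def)
  finally have "two_qubit_gates (concat (map (\<lambda>v. relabel (node_qubits v) (node_circuit n k \<alpha> v)) ?vs)) \<le> ?G * (48 * k * k)"
    using two_qubit_gates_le order_trans by blast
  moreover have "length (concat (map (\<lambda>u. relabel (leaf n k u) (encoder_circuit n k \<alpha> Is u)) [0..<?G])) \<le> length [0..<?G] * (9 * 2 ^ k)"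
    by (rule length_concat_le) (simp add: length_encoder_circuit)
  then have "two_qubit_gates (concat (map (\<lambda>u. relabel (leaf n k u) (encoder_circuit n k \<alpha> Is u)) [0..<?G])) \<le> ?G * (9 * 2 ^ k)"
    using two_qubit_gates_le[of "concat (map (\<lambda>u. relabel (leaf n k u) (encoder_circuit n k \<alpha> Is u)) [0..<?G])"] by simp
  ultimately show ?thesis
    unfolding algorithm_circuit_def two_qubit_gates_append two_qubit_gates_flip_circuit
    by (simp add: distrib_left)
qed

text \<open>Since the number of leaves is at most 2n/k, its rounded logarithm \<open>h\<close> is at
  most log(n/k) + 2. The two extra levels cost 672k; together with l \<le> k and the encoders they
  are absorbed by 2^k, as 673 + 9 \<le> 1000.\<close>

lemma depth_algorithm_circuit:
  "real (depth (n + a) (algorithm_circuit n k l \<alpha> Is)) \<le> 1000 * (real k * log 2 (real n / real k) + 2 ^ k)"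
proof -
  let ?G = "num_leaves n k" and ?L = "log 2 (real n / real k)"
  define h where "h = nat \<lceil>log 2 (real ?G)\<rceil>"
  have G: "1 \<le> real ?G" using num_leaves_bounds(3)[OF k] by simp
  then have h: "log 2 (real ?G) \<le> real h" "real h \<le> log 2 (real ?G) + 1"
    by (auto simp: h_def)
  have "real ?G = 2 powr log 2 (real ?G)" using G by simp
  also have "\<dots> \<le> 2 powr real h" using h(1) by simp
  finally have "real ?G \<le> real (2 ^ h)" by (simp add: powr_realpow)
  then have Gh: "?G \<le> 2 ^ h" by (simp only: of_nat_le_iff)
  have "real ?G \<le> 2 * (real n / real k)"
    using num_leaves_bounds(4)[OF k] k by (simp add: field_simps)
  then have "log 2 (real ?G) \<le> log 2 (2 * (real n / real k))"
    using G k by (subst log_le_cancel_iff) auto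
  also have "\<dots> = 1 + ?L" using k by (subst log_mult) auto
  finally have hL: "real h \<le> ?L + 2" using h by simp
  have L: "0 \<le> ?L" using k by simp
  have "depth (n + a) (algorithm_circuit n k l \<alpha> Is) \<le> l + (336 * k * h + 9 * 2 ^ k)"
    by (rule depth_le, rule fits_mono[OF fits_algorithm_circuit[OF Gh]]) (use k in auto)
  then have "real (depth (n + a) (algorithm_circuit n k l \<alpha> Is)) \<le> real (l + (336 * k * h + 9 * 2 ^ k))"
    by (simp only: of_nat_le_iff)
  also have "\<dots> \<le> real k + (336 * (real k * (?L + 2)) + 9 * 2 ^ k)"
    using l hL by (simp add: mult_left_mono add_mono)
  also have "\<dots> = 336 * (real k * ?L) + 673 * real k + 9 * 2 ^ k" by (simp add: algebra_simps)
  also have "\<dots> \<le> 1000 * (real k * ?L + 2 ^ k)"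
  proof -
    have "real k \<le> 2 ^ k" by (metis less_imp_le of_nat_less_two_power)
    moreover have "0 \<le> real k * ?L" using L by simp
    ultimately show ?thesis unfolding distrib_left by linarith
  qed
  finally show ?thesis .
qed

text \<open>With G leaves, G * k \<le> 2n turns the G * k^2 gates of the blocks into O(nk); for the
  encoders G \<le> 2n is enough.\<close>

lemma size_algorithm_circuit:
  "real (two_qubit_gates (algorithm_circuit n k l \<alpha> Is)) \<le> 96 * (real n * real k) + 18 * (real n * 2 ^ k)"
proof -
  let ?G = "num_leaves n k"
  have G: "real ?G * real k \<le> 2 * real n" by (rule num_leaves_bounds(4)[OF k])
  have "real ?G * 1 \<le> real ?G * real k" using k by (intro mult_left_mono) auto
  then have G': "real ?G \<le> 2 * real n" using G by simp
  have "real (two_qubit_gates (algorithm_circuit n k l \<alpha> Is)) \<le> real (?G * (48 * k * k + 9 * 2 ^ k))"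
    using two_qubit_gates_algorithm_circuit by (simp only: of_nat_le_iff)
  also have "\<dots> = 48 * ((real ?G * real k) * real k) + 9 * (real ?G * 2 ^ k)"
    by (simp add: algebra_simps)
  also have "\<dots> \<le> 48 * ((2 * real n) * real k) + 9 * ((2 * real n) * 2 ^ k)"
    using G G' by (intro add_mono mult_left_mono mult_right_mono) auto
  finally show ?thesis by simp
qed

end

theorem theorem2:
  "\<exists>c :: real. c > 0 \<and>
     (\<forall>(n :: nat) (k :: nat) (l :: nat) (\<psi> :: state) (Is :: nat list list).
        1 \<le> k \<and> k < n \<and> l \<le> k \<and>
        \<psi> \<in> weight_space n l \<and> unit_state n \<psi> \<and> leaf_separable n k l \<psi> \<and>
        distinct Is \<and> set Is = weight_tuples n k l \<longrightarrow>
        (\<exists>C. implements_algorithm n k l \<psi> Is 0 C \<and>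
             real (depth n C) \<le> c * (real k * (log 2 (real n / real k) + 2 ^ k)) \<and>
             real (two_qubit_gates C) \<le> c * (real n * real k * 2 ^ k)) \<and>
        (\<exists>C. implements_algorithm n k l \<psi> Is (num_leaves n k) C \<and>
             real (depth (n + num_leaves n k) C)
               \<le> c * (real k * log 2 (real n / real k) + 2 ^ k) \<and>
             real (two_qubit_gates C) \<le> c * (real n * (real k + 2 ^ k))))"
proof (intro exI[of _ "1000 :: real"] conjI allI impI; (elim conjE)?)
  fix n k l :: nat and \<psi> :: state and Is :: "nat list list"
  assume "1 \<le> k" and kn: "k < n" and l: "l \<le> k"
  then have k: "0 < k" by simp
  let ?C = "algorithm_circuit n k l \<psi> Is"
  note impl = implements_algorithm_circuit[OF k kn l, of \<psi> Is]
    and depth = depth_algorithm_circuit[OF k kn l, of _ \<psi> Is]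
    and size = size_algorithm_circuit[OF k kn l, of \<psi> Is]
  \<comment> \<open>The bounds of the second claim are the sharper ones; since k and 2^k are at
    least 1, they yield those of the first.\<close>
  have k1: "1 \<le> real k" "1 \<le> (2 ^ k :: real)" using k by auto
  have nk: "real n * real k \<le> real n * real k * 2 ^ k" "real n * 2 ^ k \<le> real n * real k * 2 ^ k"
    using k1 mult_left_mono[of 1 "2 ^ k" "real n * real k"] mult_left_mono[of 1 "real k" "real n * 2 ^ k"]
    by (simp_all add: mult_ac)
  have "2 ^ k \<le> real k * 2 ^ k" using k1 mult_right_mono[of 1 "real k" "2 ^ k"] by simp
  then have "1000 * (real k * log 2 (real n / real k) + 2 ^ k) \<le> 1000 * (real k * (log 2 (real n / real k) + 2 ^ k))"
    by (simp add: distrib_left)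
  then have "real (depth n ?C) \<le> 1000 * (real k * (log 2 (real n / real k) + 2 ^ k))"
    using depth[of 0] by simp
  moreover have "real (two_qubit_gates ?C) \<le> 1000 * (real n * real k * 2 ^ k)"
    using size nk by linarith
  ultimately show "\<exists>C. implements_algorithm n k l \<psi> Is 0 C \<and>
             real (depth n C) \<le> 1000 * (real k * (log 2 (real n / real k) + 2 ^ k)) \<and>
             real (two_qubit_gates C) \<le> 1000 * (real n * real k * 2 ^ k)"
    using impl by blast
  have "0 \<le> real n * real k" "0 \<le> real n * 2 ^ k" by simp_all
  then have "real (two_qubit_gates ?C) \<le> 1000 * (real n * (real k + 2 ^ k))"
    using size unfolding distrib_left by linarith
  then show "\<exists>C. implements_algorithm n k l \<psi> Is (num_leaves n k) C \<and>
             real (depth (n + num_leaves n k) C)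
               \<le> 1000 * (real k * log 2 (real n / real k) + 2 ^ k) \<and>
             real (two_qubit_gates C) \<le> 1000 * (real n * (real k + 2 ^ k))"
    using impl depth by blast
qed simp

end
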